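(* Let $p>3$ be a prime, let $\mathbb{K}$ be an algebraically closed field of characteristic $p$, and let $W$ be the modular Witt algebra over $\mathbb{K}$ with its canonical restricted Lie algebra structure. Then the restricted cohomology group $H^2(W)=H^2(W,\mathbb{K})$ with trivial coefficients satisfies $\dim_{\mathbb{K}} H^2(W)=p+1$. Moreover, there is a $p$-dimensional subspace of $H^2(W)$ such that for every class in this subspace the corresponding one-dimensional restricted central extension of $W$ is trivial when considered as an extension of ordinary Lie algebras.
   Context: Modular Witt algebra. Let $A=\mathbb{K}[x]/(x^p-1)$ and $W=\mathrm{Der}(A)$. It has basis $e_i=x^{i+1}\partial$, $i=-1,0,\dots,p-2$, with $\partial=d/dx$, and bracket $[e_i,e_j]=(j-i)e_{i+j}$, indices computed modulo $p$. It is a restricted Lie algebra with $g^{[p]}=g^p$ (the $p$-fold composition of the derivation $g$ of $A$); in particular $e_0^{[p]}=e_0$ and $e_i^{[p]}=0$ for $i\neq 0$. Iterated brackets: $[g_1,g_2,\dots,g_j]=[[\dots[[g_1,g_2],g_3],\dots],g_j]$. Ordinary cochains: $C^q_{\rm cl}(W)=\mathrm{Hom}_{\mathbb{K}}(\wedge^q W,\mathbb{K})$, with the Lie algebra (Chevalley–Eilenberg) coboundary for trivial coefficients: $\delta^1_{\rm cl}\psi(g\wedge h)=\psi([g,h])$ and $\delta^2_{\rm cl}\phi(g_1\wedge g_2\wedge g_3)=\phi([g_1,g_2]\wedge g_3)-\phi([g_1,g_3]\wedge g_2)+\phi([g_2,g_3]\wedge g_1)$. Restricted cochains. $C^1(W)=C^1_{\rm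 cl}(W)$. For $\phi\in C^2_{\rm cl}(W)$, a map $\omega:W\to\mathbb{K}$ has the $*$-property with respect to $\phi$ if for all $g,h\in W$, $\lambda\in\mathbb{K}$: $\omega(\lambda g)=\lambda^p\omega(g)$ and $$\omega(g+h)=\omega(g)+\omega(h)+\sum_{g_i\in\{g,h\},\ g_1=g,\ g_2=h}\frac{1}{\#(g)}\,\phi([g_1,g_2,\dots,g_{p-1}]\wedge g_p),$$ where the sum is over all choices of each of $g_3,\dots,g_p$ as $g$ or $h$, and $\#(g)$ is the number of factors $g_i$ equal to (chosen as) $g$. Then $C^2(W)=\{(\phi,\omega): \phi\in C^2_{\rm cl}(W),\ \omega:W\to\mathbb{K}\text{ has the }*\text{-property w.r.t. }\phi\}$, a $\mathbb{K}$-vector space under componentwise, pointwise operations. Coboundaries: $\delta^1\psi=(\delta^1_{\rm cl}\psi,\ \mathrm{ind}^1\psi)\in C^2(W)$ with $\mathrm{ind}^1\psi(g)=\psi(g^{[p]})$; and $\delta^2(\phi,\omega)=(\delta^2_{\rm cl}\phi,\ \mathrm{ind}^2(\phi,\omega))$, where $\mathrm{ind}^2(\phi,\omega):W\times W\to\mathbb{K}$ is $\mathrm{ind}^2(\phi,\omega)(g,h)=\phi(g\wedge h^{[p]})-\phi([g,\underbrace{h,\dots,h}_{p-1}]\wedge h)$. The map $\delta^2$ takes values in a space of pairs $(\alpha,\beta)$ with $\alpha\in C^3_{\rm cl}(W)$ and $\beta:W\times W\to\mathbb{K}$; its kernel consists of the $(\phi,\omega)$ with $\delta^2_{\rm cl}\phi=0$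 and $\mathrm{ind}^2(\phi,\omega)=0$. Define $H^2(W)=\ker\delta^2/\mathrm{im}\,\delta^1$. Correspondence with extensions. To a cocycle $(\phi,\omega)\in\ker\delta^2$ corresponds the one-dimensional restricted central extension $E=W\oplus\mathbb{K}c$ of $W$ with, for $g,h\in W$, $\alpha,\beta\in\mathbb{K}$, $$[g+\alpha c,h+\beta c]=[g,h]+\phi(g\wedge h)c,\qquad (g+\alpha c)^{[p]}=g^{[p]}+\omega(g)c;$$ its equivalence class depends only on the cohomology class of $(\phi,\omega)$. The extension is trivial as an ordinary Lie algebra extension if the projection $E\to W$ has a section that is a Lie algebra homomorphism (not necessarily compatible with the $p$-operations). *)

theory Defs
  imports
    "HOL-Computational_Algebra.Computational_Algebra"
    "HOL-Library.Function_Algebras"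
    "HOL-Library.Product_Plus"
begin

section \<open>The truncated polynomial algebra \<open>A = K[x]/(x^p - 1)\<close>, \<open>p = char K\<close>\<close>

definition trunc_rel :: "'k::field_prime_char poly \<Rightarrow> 'k poly \<Rightarrow> bool" where
  "trunc_rel f g \<longleftrightarrow> (monom 1 CHAR('k) - 1) dvd (f - g)"

quotient_type (overloaded) 'k trunc_poly = "'k::field_prime_char poly" / trunc_rel
proof (rule equivpI)
  show "reflp (trunc_rel :: 'k poly \<Rightarrow> _)"
    by (rule reflpI) (simp add: trunc_rel_def)
  show "symp (trunc_rel :: 'k poly \<Rightarrow> _)"
    by (rule sympI) (metis dvd_minus_iff minus_diff_eq trunc_rel_def)
  show "transp (trunc_rel :: 'k poly \<Rightarrow> _)"
  proof (rule transpI)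
    fix f g h :: "'k poly"
    assume "trunc_rel f g" "trunc_rel g h"
    then show "trunc_rel f h"
      unfolding trunc_rel_def using dvd_add[of _ "f - g" "g - h"] by simp
  qed
qed

instantiation trunc_poly :: (field_prime_char) comm_ring_1
begin

lift_definition zero_trunc_poly :: "'a trunc_poly" is 0 .
lift_definition one_trunc_poly :: "'a trunc_poly" is 1 .
lift_definition plus_trunc_poly :: "'a trunc_poly \<Rightarrow> 'a trunc_poly \<Rightarrow> 'a trunc_poly" is "(+)"
  unfolding trunc_rel_def by (metis dvd_add add_diff_add)
lift_definition uminus_trunc_poly :: "'a trunc_poly \<Rightarrow> 'a trunc_poly" is uminus
  unfolding trunc_rel_def by (metis dvd_minus_iff minus_diff_minus)
lift_definition minus_trunc_poly :: "'a trunc_poly \<Rightarrow> 'a trunc_poly \<Rightarrow> 'a trunc_poly" is "(-)"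
  unfolding trunc_rel_def by (metis dvd_diff diff_diff_eq2 add_diff_eq diff_add_eq diff_diff_eq add.commute)
lift_definition times_trunc_poly :: "'a trunc_poly \<Rightarrow> 'a trunc_poly \<Rightarrow> 'a trunc_poly" is "(*)"
proof -
  fix f f' g g' :: "'a poly"
  assume "trunc_rel f f'" "trunc_rel g g'"
  moreover have "f * g - f' * g' = (f - f') * g + f' * (g - g')"
    by (simp add: algebra_simps)
  ultimately show "trunc_rel (f * g) (f' * g')"
    unfolding trunc_rel_def by simp
qed

instance
proof
  show "(0::'a trunc_poly) \<noteq> 1"
  proof (transfer, unfold trunc_rel_def, rule notI)
    assume "(monom 1 CHAR('a) - 1 :: 'a poly) dvd 0 - 1"
    then have "(monom 1 CHAR('a) - 1 :: 'a poly) dvd 1"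
      by simp
    then have "poly (monom 1 CHAR('a) - 1 :: 'a poly) 1 dvd 1"
      by (metis dvdE dvdI poly_1 poly_mult)
    then show False
      by (simp add: poly_monom)
  qed
qed (transfer; simp add: trunc_rel_def algebra_simps)+

end

lift_definition trunc_scale :: "'k \<Rightarrow> 'k::field_prime_char trunc_poly \<Rightarrow> 'k trunc_poly" is smult
  unfolding trunc_rel_def by (metis dvd_smult smult_diff_right)

interpretation trunc_vs: vector_space "trunc_scale :: 'k::field_prime_char \<Rightarrow> _"
  by standard (transfer; simp add: trunc_rel_def smult_add_left smult_add_right)+

lemma trunc_scale_mult:
  "trunc_scale c f * g = trunc_scale c (f * g)" "f * trunc_scale c g = trunc_scale c (f * g)"
  by (transfer; simp add: trunc_rel_def)+


section \<open>The Witt algebra \<open>W = Der(A)\<close>\<close>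

definition is_derivation :: "('k::field_prime_char trunc_poly \<Rightarrow> 'k trunc_poly) \<Rightarrow> bool" where
  "is_derivation D \<longleftrightarrow>
     Vector_Spaces.linear trunc_scale trunc_scale D \<and> (\<forall>f g. D (f * g) = D f * g + f * D g)"

lemma is_derivation_iff:
  "is_derivation D \<longleftrightarrow>
     (\<forall>f g. D (f + g) = D f + D g) \<and> (\<forall>c f. D (trunc_scale c f) = trunc_scale c (D f)) \<and>
     (\<forall>f g. D (f * g) = D f * g + f * D g)"
  unfolding is_derivation_def
  by (auto simp: Vector_Spaces.linear_def module_hom_def module_hom_axioms_def
      trunc_vs.vector_space_axioms trunc_vs.module_axioms)

typedef (overloaded) 'k witt = "{D :: 'k::field_prime_char trunc_poly \<Rightarrow> 'k trunc_poly. is_derivation D}"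
  by (rule exI[of _ "\<lambda>_. 0"]) (simp add: is_derivation_iff)

setup_lifting type_definition_witt

instantiation witt :: (field_prime_char) ab_group_add
begin

lift_definition zero_witt :: "'a witt" is "\<lambda>_. 0"
  by (simp add: is_derivation_iff)
lift_definition plus_witt :: "'a witt \<Rightarrow> 'a witt \<Rightarrow> 'a witt" is "\<lambda>D E f. D f + E f"
  by (simp add: is_derivation_iff algebra_simps trunc_vs.scale_right_distrib)
lift_definition uminus_witt :: "'a witt \<Rightarrow> 'a witt" is "\<lambda>D f. - D f"
  by (simp add: is_derivation_iff algebra_simps)
lift_definition minus_witt :: "'a witt \<Rightarrow> 'a witt \<Rightarrow> 'a witt" is "\<lambda>D E f. D f - E f"
  by (simp add: is_derivation_iff algebra_simps trunc_vs.scale_right_diff_distrib)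

instance
  by standard (transfer; simp add: fun_eq_iff algebra_simps)+

end

lift_definition witt_scale :: "'k \<Rightarrow> 'k::field_prime_char witt \<Rightarrow> 'k witt" is
  "\<lambda>c D f. trunc_scale c (D f)"
  by (simp add: is_derivation_iff trunc_vs.scale_right_distrib trunc_scale_mult
      trunc_vs.scale_left_commute)

interpretation witt_vs: vector_space "witt_scale :: 'k::field_prime_char \<Rightarrow> _"
  by standard
    (transfer; simp add: fun_eq_iff trunc_vs.scale_right_distrib trunc_vs.scale_left_distrib)+

lift_definition witt_bracket :: "'k::field_prime_char witt \<Rightarrow> 'k witt \<Rightarrow> 'k witt" is
  "\<lambda>D E f. D (E f) - E (D f)"
  by (simp add: is_derivation_iff trunc_vs.scale_right_diff_distrib algebra_simps)

lemma is_derivation_funpow_mult: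
  assumes "is_derivation D"
  shows "(D ^^ n) (f * g) = (\<Sum>k\<le>n. of_nat (n choose k) * ((D ^^ k) f * (D ^^ (n - k)) g))"
proof (induction n)
  case (Suc n)
  have D: "D (f + g) = D f + D g" "D (f * g) = D f * g + f * D g" for f g
    using assms by (auto simp: is_derivation_iff)
  have "D (0 + 0) = D 0 + D 0" by (rule D)
  then have D0: "D 0 = 0" by simp
  have Dsum: "D (sum h A) = (\<Sum>k\<in>A. D (h k))" for h and A :: "nat set"
    by (induction A rule: infinite_finite_induct) (simp_all add: D D0)
  have Dnat: "D (of_nat m * h) = of_nat m * D h" for m h
    by (induction m) (simp_all add: D D0 algebra_simps)
  let ?t = "\<lambda>k l. (D ^^ k) f * (D ^^ l) g"
  have "(D ^^ Suc n) (f * g) = (\<Sum>k\<le>n. of_nat (n choose k) * ?t (Suc k) (n - k))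
      + (\<Sum>k\<le>n. of_nat (n choose k) * ?t k (Suc (n - k)))"
    by (simp add: Suc.IH Dsum Dnat D(2)[of "(D ^^ _) f"] ring_distribs sum.distrib)
  also have "(\<Sum>k\<le>n. of_nat (n choose k) * ?t k (Suc (n - k))) =
      (\<Sum>k\<le>n. of_nat (n choose k) * ?t k (Suc n - k))"
    by (intro sum.cong) (simp_all add: Suc_diff_le del: funpow.simps)
  also have "\<dots> = (\<Sum>k\<le>Suc n. of_nat (n choose k) * ?t k (Suc n - k))"
    by (simp add: binomial_eq_0 del: funpow.simps)
  also have "\<dots> = ?t 0 (Suc n) + (\<Sum>k\<le>n. of_nat (n choose Suc k) * ?t (Suc k) (n - k))"
    by (subst sum.atMost_Suc_shift) simp
  also have "(\<Sum>k\<le>n. of_nat (n choose k) * ?t (Suc k) (n - k)) + \<dots> =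
      ?t 0 (Suc n) + (\<Sum>k\<le>n. of_nat (Suc n choose Suc k) * ?t (Suc k) (n - k))"
    by (simp add: ring_distribs sum.distrib del: funpow.simps)
  also have "\<dots> = (\<Sum>k\<le>Suc n. of_nat (Suc n choose k) * ?t k (Suc n - k))"
    by (subst sum.atMost_Suc_shift) (simp del: funpow.simps binomial_Suc_Suc)
  finally show ?case .
qed simp

lemma of_nat_trunc_poly_eq_0:
  assumes "CHAR('k) dvd n"
  shows "(of_nat n :: 'k::field_prime_char trunc_poly) = 0"
proof -
  have "(of_nat n :: 'k trunc_poly) = trunc_scale (of_nat n) 1"
    by (induction n) (simp_all add: trunc_vs.scale_left_distrib)
  also have "(of_nat n :: 'k) = 0"
    using assms by (simp add: of_nat_eq_0_iff_char_dvd)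
  finally show ?thesis by simp
qed

lift_definition witt_pmap :: "'k::field_prime_char witt \<Rightarrow> 'k witt" is "\<lambda>D. D ^^ CHAR('k)"
proof -
  fix D :: "'k trunc_poly \<Rightarrow> 'k trunc_poly"
  assume D: "is_derivation D"
  let ?p = "CHAR('k)"
  have "(D ^^ n) (f + g) = (D ^^ n) f + (D ^^ n) g"
    "(D ^^ n) (trunc_scale c f) = trunc_scale c ((D ^^ n) f)" for n c f g
    using D by (induction n) (simp_all add: is_derivation_iff)
  moreover have "(D ^^ ?p) (f * g) = (D ^^ ?p) f * g + f * (D ^^ ?p) g" for f g
  proof -
    have "(D ^^ ?p) (f * g) = (\<Sum>k\<le>?p. of_nat (?p choose k) * ((D ^^ k) f * (D ^^ (?p - k)) g))"
      by (rule is_derivation_funpow_mult[OF D])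
    also have "\<dots> = (\<Sum>k\<in>{0, ?p}. of_nat (?p choose k) * ((D ^^ k) f * (D ^^ (?p - k)) g))"
    proof (rule sum.mono_neutral_right)
      show "\<forall>k\<in>{..?p} - {0, ?p}. of_nat (?p choose k) * ((D ^^ k) f * (D ^^ (?p - k)) g) = 0"
      proof
        fix k assume "k \<in> {..?p} - {0, ?p}"
        then have "?p dvd (?p choose k)"
          by (intro dvd_choose_prime) auto
        then show "of_nat (?p choose k) * ((D ^^ k) f * (D ^^ (?p - k)) g) = 0"
          by (simp add: of_nat_trunc_poly_eq_0)
      qed
    qed auto
    also have "\<dots> = (D ^^ ?p) f * g + f * (D ^^ ?p) g"
      by (simp add: add.commute)
    finally show ?thesis .
  qed
  ultimately show "is_derivation (D ^^ ?p)"
    by (simp add: is_derivation_iff)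
qed

text \<open>The left-normed bracket \<open>[c 1, c 2, \<dots>, c j]\<close>, for \<open>j \<ge> 1\<close>.\<close>
definition iter_bracket :: "(nat \<Rightarrow> 'k::field_prime_char witt) \<Rightarrow> nat \<Rightarrow> 'k witt" where
  "iter_bracket c j = foldl witt_bracket (c 1) (map c [2..<Suc j])"


section \<open>Restricted cochains\<close>

definition cochain1 :: "('k::field_prime_char witt \<Rightarrow> 'k) set" where
  "cochain1 = {\<psi>. Vector_Spaces.linear witt_scale (*) \<psi>}"

text \<open>Linear forms on the exterior square are represented as alternating bilinear forms.\<close>
definition cl_cochain2 :: "('k::field_prime_char witt \<Rightarrow> 'k witt \<Rightarrow> 'k) set" where
  "cl_cochain2 = {\<phi>. (\<forall>g. Vector_Spaces.linear witt_scale (*) (\<phi> g)) \<and>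
     (\<forall>h. Vector_Spaces.linear witt_scale (*) (\<lambda>g. \<phi> g h)) \<and> (\<forall>g. \<phi> g g = 0)}"

text \<open>
  A choice of the factors \<open>g\<^sub>1, \<dots>, g\<^sub>p\<close> with \<open>g\<^sub>1 = g\<close> and \<open>g\<^sub>2 = h\<close> is recorded by the set
  \<open>S \<subseteq> {3..p}\<close> of those later positions at which \<open>g\<close> is chosen. Choices are formal: they are
  counted separately even if \<open>g = h\<close>.
\<close>
definition factor :: "nat set \<Rightarrow> 'w \<Rightarrow> 'w \<Rightarrow> nat \<Rightarrow> 'w" where
  "factor S g h i = (if i = 1 then g else if i = 2 then h else if i \<in> S then g else h)"

definition star_sum ::
  "('k::field_prime_char witt \<Rightarrow> 'k witt \<Rightarrow> 'k) \<Rightarrow> 'k witt \<Rightarrow> 'k witt \<Rightarrow> 'k" where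
  "star_sum \<phi> g h = (\<Sum>S\<in>Pow {3..CHAR('k)}.
     1 / of_nat (card (insert 1 S)) *
     \<phi> (iter_bracket (factor S g h) (CHAR('k) - 1)) (factor S g h CHAR('k)))"

definition star_property ::
  "('k::field_prime_char witt \<Rightarrow> 'k witt \<Rightarrow> 'k) \<Rightarrow> ('k witt \<Rightarrow> 'k) \<Rightarrow> bool" where
  "star_property \<phi> \<omega> \<longleftrightarrow>
     (\<forall>c g. \<omega> (witt_scale c g) = c ^ CHAR('k) * \<omega> g) \<and>
     (\<forall>g h. \<omega> (g + h) = \<omega> g + \<omega> h + star_sum \<phi> g h)"

type_synonym 'k cochain2 = "('k witt \<Rightarrow> 'k witt \<Rightarrow> 'k) \<times> ('k witt \<Rightarrow> 'k)"

definition res_cochain2 :: "'k::field_prime_char cochain2 set" where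
  "res_cochain2 = {(\<phi>, \<omega>). \<phi> \<in> cl_cochain2 \<and> star_property \<phi> \<omega>}"

definition cochain2_scale :: "'k \<Rightarrow> 'k::field_prime_char cochain2 \<Rightarrow> 'k cochain2" where
  "cochain2_scale c = (\<lambda>(\<phi>, \<omega>). (\<lambda>g h. c * \<phi> g h, \<lambda>g. c * \<omega> g))"

definition cl_delta1 :: "('k::field_prime_char witt \<Rightarrow> 'k) \<Rightarrow> 'k witt \<Rightarrow> 'k witt \<Rightarrow> 'k" where
  "cl_delta1 \<psi> g h = \<psi> (witt_bracket g h)"

definition ind1 :: "('k::field_prime_char witt \<Rightarrow> 'k) \<Rightarrow> 'k witt \<Rightarrow> 'k" where
  "ind1 \<psi> g = \<psi> (witt_pmap g)"

definition delta1 :: "('k::field_prime_char witt \<Rightarrow> 'k) \<Rightarrow> 'k cochain2" where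
  "delta1 \<psi> = (cl_delta1 \<psi>, ind1 \<psi>)"

definition cl_delta2 ::
  "('k::field_prime_char witt \<Rightarrow> 'k witt \<Rightarrow> 'k) \<Rightarrow> 'k witt \<Rightarrow> 'k witt \<Rightarrow> 'k witt \<Rightarrow> 'k" where
  "cl_delta2 \<phi> g1 g2 g3 =
     \<phi> (witt_bracket g1 g2) g3 - \<phi> (witt_bracket g1 g3) g2 + \<phi> (witt_bracket g2 g3) g1"

definition ind2 :: "'k::field_prime_char cochain2 \<Rightarrow> 'k witt \<Rightarrow> 'k witt \<Rightarrow> 'k" where
  "ind2 = (\<lambda>(\<phi>, \<omega>) g h. \<phi> g (witt_pmap h) -
     \<phi> (iter_bracket (\<lambda>i. if i = 1 then g else h) CHAR('k)) h)"

definition delta2 :: "'k::field_prime_char cochain2 \<Rightarrow>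
    ('k witt \<Rightarrow> 'k witt \<Rightarrow> 'k witt \<Rightarrow> 'k) \<times> ('k witt \<Rightarrow> 'k witt \<Rightarrow> 'k)" where
  "delta2 x = (cl_delta2 (fst x), ind2 x)"


section \<open>The restricted cohomology group \<open>H^2(W)\<close>\<close>

definition cocycles2 :: "'k::field_prime_char cochain2 set" where
  "cocycles2 = {x \<in> res_cochain2. delta2 x = 0}"

definition coboundaries2 :: "'k::field_prime_char cochain2 set" where
  "coboundaries2 = delta1 ` cochain1"

interpretation cochain2_vs: vector_space "cochain2_scale :: 'k::field_prime_char \<Rightarrow> _"
  by standard
    (auto simp: cochain2_scale_def fun_eq_iff plus_prod_def algebra_simps split: prod.splits)

lemma linear_witt_iff:
  "Vector_Spaces.linear witt_scale ((*) :: 'k \<Rightarrow> 'k \<Rightarrow> 'k) \<psi> \<longleftrightarrow>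
     (\<forall>g h. \<psi> (g + h) = \<psi> g + \<psi> h) \<and>
     (\<forall>c g. \<psi> (witt_scale c g) = c * (\<psi> g :: 'k::field_prime_char))"
proof -
  interpret s: vector_space "(*) :: 'k \<Rightarrow> 'k \<Rightarrow> 'k"
    by standard (simp_all add: algebra_simps)
  show ?thesis
    by (auto simp: Vector_Spaces.linear_def module_hom_def module_hom_axioms_def
        witt_vs.vector_space_axioms witt_vs.module_axioms s.vector_space_axioms s.module_axioms)
qed

lemma star_sum_add: "star_sum (\<phi> + \<phi>') g h = star_sum \<phi> g h + star_sum \<phi>' g h"
  by (simp add: star_sum_def ring_distribs sum.distrib)

lemma star_sum_scale: "star_sum (\<lambda>g h. c * \<phi> g h) g h = c * star_sum \<phi> g h"
  by (simp add: star_sum_def sum_distrib_left mult.left_commute)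

lemma subspace_cocycles2: "cochain2_vs.subspace cocycles2"
proof (rule cochain2_vs.subspaceI)
  have "star_sum 0 g h = 0" for g h :: "'a witt"
    by (simp add: star_sum_def)
  then show "(0 :: 'a cochain2) \<in> cocycles2"
    by (auto simp: cocycles2_def res_cochain2_def cl_cochain2_def star_property_def zero_prod_def
        linear_witt_iff delta2_def cl_delta2_def ind2_def fun_eq_iff)
next
  fix x y :: "'a cochain2"
  assume "x \<in> cocycles2" "y \<in> cocycles2"
  then show "x + y \<in> cocycles2"
    by (cases x; cases y)
      (auto simp: cocycles2_def res_cochain2_def cl_cochain2_def star_property_def zero_prod_def
        linear_witt_iff delta2_def cl_delta2_def ind2_def fun_eq_iff star_sum_add algebra_simps)
next
  fix c and x :: "'a cochain2"
  assume "x \<in> cocycles2"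
  then show "cochain2_scale c x \<in> cocycles2"
    by (cases x)
      (auto simp: cocycles2_def res_cochain2_def cl_cochain2_def star_property_def zero_prod_def
        linear_witt_iff delta2_def cl_delta2_def ind2_def fun_eq_iff star_sum_scale
        cochain2_scale_def distrib_left mult.left_commute
        simp flip: right_diff_distrib distrib_left)
qed

lemma subspace_coboundaries2: "cochain2_vs.subspace coboundaries2"
proof (rule cochain2_vs.subspaceI)
  have "(\<lambda>_. 0) \<in> (cochain1 :: ('a witt \<Rightarrow> 'a) set)" "delta1 (\<lambda>_. 0) = (0 :: 'a cochain2)"
    by (simp_all add: cochain1_def linear_witt_iff delta1_def cl_delta1_def ind1_def zero_prod_def
        fun_eq_iff)
  then show "(0 :: 'a cochain2) \<in> coboundaries2"
    unfolding coboundaries2_def by (metis imageI)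
next
  fix x y :: "'a cochain2"
  assume "x \<in> coboundaries2" "y \<in> coboundaries2"
  then obtain \<psi> \<psi>' where \<psi>: "\<psi> \<in> cochain1" "x = delta1 \<psi>" "\<psi>' \<in> cochain1" "y = delta1 \<psi>'"
    by (auto simp: coboundaries2_def)
  then have "\<psi> + \<psi>' \<in> cochain1" "x + y = delta1 (\<psi> + \<psi>')"
    by (auto simp: cochain1_def linear_witt_iff delta1_def cl_delta1_def ind1_def fun_eq_iff
        algebra_simps)
  then show "x + y \<in> coboundaries2"
    unfolding coboundaries2_def by blast
next
  fix c and x :: "'a cochain2"
  assume "x \<in> coboundaries2"
  then obtain \<psi> where \<psi>: "\<psi> \<in> cochain1" "x = delta1 \<psi>"
    by (auto simp: coboundaries2_def)
  then have "(\<lambda>g. c * \<psi> g) \<in> cochain1" "cochain2_scale c x = delta1 (\<lambda>g. c * \<psi> g)"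
    by (auto simp: cochain1_def linear_witt_iff delta1_def cl_delta1_def ind1_def fun_eq_iff
        cochain2_scale_def algebra_simps)
  then show "cochain2_scale c x \<in> coboundaries2"
    unfolding coboundaries2_def by blast
qed

definition cohomologous :: "'k::field_prime_char cochain2 \<Rightarrow> 'k cochain2 \<Rightarrow> bool" where
  "cohomologous x y \<longleftrightarrow> x \<in> cocycles2 \<and> y \<in> cocycles2 \<and> x - y \<in> coboundaries2"

text \<open>
  The relation is partial, since only cocycles have a class; \<open>abs_res_H2\<close> maps a cocycle to its
  class and is unspecified on other pairs.
\<close>
quotient_type (overloaded) 'k res_H2 = "'k::field_prime_char cochain2" / partial: cohomologous
proof (rule part_equivpI)
  show "\<exists>x :: 'k cochain2. cohomologous x x"
    using cochain2_vs.subspace_0[OF subspace_cocycles2]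
      cochain2_vs.subspace_0[OF subspace_coboundaries2]
    by (intro exI[of _ 0]) (simp add: cohomologous_def)
  show "symp (cohomologous :: 'k cochain2 \<Rightarrow> _)"
  proof (rule sympI)
    fix x y :: "'k cochain2"
    assume "cohomologous x y"
    then show "cohomologous y x"
      using cochain2_vs.subspace_neg[OF subspace_coboundaries2, of "x - y"]
      by (simp add: cohomologous_def)
  qed
  show "transp (cohomologous :: 'k cochain2 \<Rightarrow> _)"
  proof (rule transpI)
    fix x y z :: "'k cochain2"
    assume "cohomologous x y" "cohomologous y z"
    then show "cohomologous x z"
      using cochain2_vs.subspace_add[OF subspace_coboundaries2, of "x - y" "y - z"]
      by (simp add: cohomologous_def)
  qed
qed

instantiation res_H2 :: (field_prime_char) ab_group_add
begin

lift_definition zero_res_H2 :: "'a res_H2" is 0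
  by (simp add: cohomologous_def cochain2_vs.subspace_0 subspace_cocycles2 subspace_coboundaries2)
lift_definition plus_res_H2 :: "'a res_H2 \<Rightarrow> 'a res_H2 \<Rightarrow> 'a res_H2" is "(+)"
  unfolding cohomologous_def
  by (metis add_diff_add cochain2_vs.subspace_add subspace_cocycles2 subspace_coboundaries2)
lift_definition uminus_res_H2 :: "'a res_H2 \<Rightarrow> 'a res_H2" is uminus
  unfolding cohomologous_def
  by (metis minus_diff_minus cochain2_vs.subspace_neg subspace_cocycles2 subspace_coboundaries2)
lift_definition minus_res_H2 :: "'a res_H2 \<Rightarrow> 'a res_H2 \<Rightarrow> 'a res_H2" is "(-)"
proof -
  fix x x' y y' :: "'a cochain2"
  assume "cohomologous x x'" "cohomologous y y'"
  moreover have "(x - y) - (x' - y') = (x - x') - (y - y')"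
    by (simp add: algebra_simps)
  ultimately show "cohomologous (x - y) (x' - y')"
    unfolding cohomologous_def
    by (metis cochain2_vs.subspace_diff subspace_cocycles2 subspace_coboundaries2)
qed

instance
  by standard
    (transfer; simp add: cohomologous_def algebra_simps cochain2_vs.subspace_0
      cochain2_vs.subspace_add cochain2_vs.subspace_diff cochain2_vs.subspace_neg
      subspace_cocycles2 subspace_coboundaries2)+

end

lift_definition res_H2_scale :: "'k \<Rightarrow> 'k::field_prime_char res_H2 \<Rightarrow> 'k res_H2" is cochain2_scale
  unfolding cohomologous_def
  by (metis cochain2_vs.scale_right_diff_distrib cochain2_vs.subspace_scale subspace_cocycles2
      subspace_coboundaries2)

interpretation res_H2_vs: vector_space "res_H2_scale :: 'k::field_prime_char \<Rightarrow> _"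
  by standard
    (transfer; simp add: cohomologous_def cochain2_vs.scale_right_distrib
      cochain2_vs.scale_left_distrib cochain2_vs.subspace_0 cochain2_vs.subspace_add
      cochain2_vs.subspace_scale subspace_cocycles2 subspace_coboundaries2)+


section \<open>Restricted central extensions by a one-dimensional centre\<close>

text \<open>The additive structure is that of the carrier type.\<close>
record ('k, 'b) restricted_lie =
  scal :: "'k \<Rightarrow> 'b \<Rightarrow> 'b"
  brac :: "'b \<Rightarrow> 'b \<Rightarrow> 'b"
  pmap :: "'b \<Rightarrow> 'b"

definition witt_algebra :: "('k::field_prime_char, 'k witt) restricted_lie" where
  "witt_algebra = \<lparr>scal = witt_scale, brac = witt_bracket, pmap = witt_pmap\<rparr>"

text \<open>The pair \<open>(g, a)\<close> stands for \<open>g + a c\<close>.\<close>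
definition central_extension ::
  "'k::field_prime_char cochain2 \<Rightarrow> ('k, 'k witt \<times> 'k) restricted_lie" where
  "central_extension = (\<lambda>(\<phi>, \<omega>).
     \<lparr>scal = (\<lambda>c (g, a). (witt_scale c g, c * a)),
      brac = (\<lambda>(g, a) (h, b). (witt_bracket g h, \<phi> g h)),
      pmap = (\<lambda>(g, a). (witt_pmap g, \<omega> g))\<rparr>)"

text \<open>Homomorphisms of ordinary Lie algebras: the \<open>p\<close>-operations play no role.\<close>
definition lie_hom ::
  "('k::field, 'b::ab_group_add) restricted_lie \<Rightarrow> ('k, 'c::ab_group_add) restricted_lie \<Rightarrow>
    ('b \<Rightarrow> 'c) \<Rightarrow> bool" where
  "lie_hom L M f \<longleftrightarrow> Vector_Spaces.linear (scal L) (scal M) f \<and>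
     (\<forall>x y. f (brac L x y) = brac M (f x) (f y))"

definition lie_trivial_extension ::
  "('k::field_prime_char, 'k witt \<times> 'k) restricted_lie \<Rightarrow> bool" where
  "lie_trivial_extension E \<longleftrightarrow> (\<exists>s. lie_hom witt_algebra E s \<and> (\<forall>g. fst (s g) = g))"

end

theory Submission
  imports Defs
begin

text \<open>
  A Lie algebra two-cocycle \<open>\<phi>\<close> turns \<open>E = W \<oplus> K c\<close> into a Lie algebra, and the sum in the star property
  is the \<open>c\<close>-component of Jacobson's polynomial of \<open>E\<close>, i.e. the formal integral over \<open>0 \<le> t \<le> 1\<close> of the
  one-form \<open>x \<mapsto> [g, x, \<dots>, x]\<close> along \<open>x = h + t g\<close>. In characteristic \<open>p\<close> this one-form is closed, by
  Leibniz' rule and the hockey-stick identity. Hence Jacobson's polynomial is a symmetric two-cocycle of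
  the additive group, which splits along the lines spanned by a basis, so every \<open>\<phi>\<close> has a companion \<open>\<omega>\<close>;
  it is unique up to the \<open>p\<close>-dimensional space of \<open>p\<close>-semilinear forms. The condition \<open>ind\<^sup>2 = 0\<close> is
  automatic because \<open>W\<close> is perfect. Since the ordinary second cohomology is spanned by the Virasoro
  cocycle \<open>(e\<^sub>i, e\<^bsub>-i\<^esub>) \<mapsto> i\<^sup>3 - i\<close>, the dimension is \<open>p + 1\<close>, and the \<open>p\<close>-semilinear forms span the
  subspace of classes that are trivial as ordinary extensions.
\<close>

section \<open>Formal polynomials over an abelian group\<close>

text \<open>Repeated addition makes sense in any abelian group, so the calculus below applies alike
  to \<open>W\<close>, to \<open>A\<close>, to the extensions of \<open>W\<close>, and to sequences
  and double sequences over them.\<close>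

definition nmul :: "nat \<Rightarrow> 'a::ab_group_add \<Rightarrow> 'a" where
  "nmul n x = (\<Sum>_<n. x)"

lemma nmul_0 [simp]: "nmul 0 x = 0"
  and nmul_Suc: "nmul (Suc n) x = nmul n x + x"
  and nmul_1 [simp]: "nmul (Suc 0) x = x"
  by (simp_all add: nmul_def)

lemma nmul_zero [simp]: "nmul n 0 = 0"
  by (simp add: nmul_def)

lemma nmul_add: "nmul (m + n) x = nmul m x + nmul n x"
  by (induction n) (simp_all add: nmul_Suc add.assoc)

lemma nmul_add_right: "nmul n (x + y) = nmul n x + nmul n y"
  by (simp add: nmul_def sum.distrib)

lemma nmul_minus: "nmul n (- x) = - nmul n x"
  by (simp add: nmul_def sum_negf)

lemma nmul_mult: "nmul (m * n) x = nmul m (nmul n x)"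
  by (induction m) (simp_all add: nmul_Suc nmul_add add.commute)

lemma nmul_fun: "nmul n f = (\<lambda>i. nmul n (f i))"
  by (induction n) (simp_all add: nmul_Suc fun_eq_iff)

lemma nmul_dvd: "nmul m x = 0 \<Longrightarrow> m dvd n \<Longrightarrow> nmul n x = 0"
  by (elim dvdE) (simp add: mult.commute[of m] nmul_mult)

lemma additive_nmul: "additive f \<Longrightarrow> f (nmul n x) = nmul n (f x)"
  by (simp add: nmul_def additive.sum)

lemma (in vector_space) nmul_conv_scale: "nmul n x = scale (of_nat n) x"
  by (induction n) (simp_all add: nmul_Suc scale_left_distrib add.commute)

lemma additive_funpow:
  fixes f :: "'a::ab_group_add \<Rightarrow> 'a"
  shows "additive f \<Longrightarrow> additive (f ^^ n)"
  by (induction n) (simp_all add: additive_def)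

text \<open>Multiplication by the variable t on coefficient sequences.\<close>

definition shift :: "(nat \<Rightarrow> 'a::zero) \<Rightarrow> nat \<Rightarrow> 'a" where
  "shift f n = (case n of 0 \<Rightarrow> 0 | Suc m \<Rightarrow> f m)"

lemma shift_simps [simp]: "shift f 0 = 0" "shift f (Suc n) = f n"
  by (simp_all add: shift_def)

definition const0 :: "'a::zero \<Rightarrow> nat \<Rightarrow> 'a" where
  "const0 v n = (if n = 0 then v else 0)"

text \<open>The linear polynomial \<open>X\<^sub>0 + t X\<^sub>1\<close> of operators, acting on formal polynomials in \<open>t\<close>.\<close>
definition lin_op :: "('a::ab_group_add \<Rightarrow> 'a) \<Rightarrow> ('a \<Rightarrow> 'a) \<Rightarrow> (nat \<Rightarrow> 'a) \<Rightarrow> nat \<Rightarrow> 'a" where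
  "lin_op X0 X1 f = (\<lambda>i. X0 (f i)) + shift (\<lambda>i. X1 (f i))"

text \<open>The product of two formal polynomials whose coefficients are paired by
  \<open>b\<close>.\<close>

definition conv :: "('a \<Rightarrow> 'b \<Rightarrow> 'c::comm_monoid_add) \<Rightarrow> (nat \<Rightarrow> 'a) \<Rightarrow> (nat \<Rightarrow> 'b) \<Rightarrow> nat \<Rightarrow> 'c" where
  "conv b f g n = (\<Sum>i\<le>n. b (f i) (g (n - i)))"

definition fderiv :: "(nat \<Rightarrow> 'a::ab_group_add) \<Rightarrow> nat \<Rightarrow> 'a" where
  "fderiv f n = nmul (Suc n) (f (Suc n))"

definition biadditive :: "('a::ab_group_add \<Rightarrow> 'b::ab_group_add \<Rightarrow> 'c::ab_group_add) \<Rightarrow> bool" where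
  "biadditive b \<longleftrightarrow> (\<forall>x x' y. b (x + x') y = b x y + b x' y) \<and> (\<forall>x y y'. b x (y + y') = b x y + b x y')"

lemma biadditiveD:
  assumes "biadditive b"
  shows "additive (b x)" "additive (\<lambda>x. b x y)"
  using assms by (auto simp: biadditive_def additive_def)

lemma biadditive_simps:
  assumes "biadditive b"
  shows "b (x + x') y = b x y + b x' y" "b x (y + y') = b x y + b x y'"
    "b 0 y = 0" "b x 0 = 0" "b (- x) y = - b x y" "b x (- y) = - b x y"
  using assms additive.zero[OF biadditiveD(1)[OF assms]] additive.zero[OF biadditiveD(2)[OF assms]]
    additive.minus[OF biadditiveD(1)[OF assms]] additive.minus[OF biadditiveD(2)[OF assms]]
  by (auto simp: biadditive_def)

text \<open>Three operators instead of one: the pairing is either the bracket of a Lie algebra or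
  the action of \<open>W\<close> on \<open>A\<close>, and in the second case \<open>X\<close> and
  \<open>Y\<close> live on different spaces.\<close>

definition leibniz :: "('c::plus \<Rightarrow> 'c) \<Rightarrow> ('a \<Rightarrow> 'a) \<Rightarrow> ('b \<Rightarrow> 'b) \<Rightarrow> ('a \<Rightarrow> 'b \<Rightarrow> 'c) \<Rightarrow> bool" where
  "leibniz Z X Y b \<longleftrightarrow> (\<forall>v w. Z (b v w) = b (X v) w + b v (Y w))"

lemma additive_lin_op:
  assumes "additive X0" "additive X1"
  shows "additive (lin_op X0 X1)"
  using assms by (auto simp: additive_def lin_op_def fun_eq_iff shift_def split: nat.splits)

lemma biadditive_conv: "biadditive b \<Longrightarrow> biadditive (conv b)"
  by (simp add: biadditive_def conv_def fun_eq_iff sum.distrib)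

lemma conv_const0: "biadditive b \<Longrightarrow> conv b f (const0 v) = (\<lambda>n. b (f n) v)"
proof (rule ext)
  fix n assume b: "biadditive b"
  have "conv b f (const0 v) n = (\<Sum>i\<in>{n}. b (f i) (const0 v (n - i)))"
    unfolding conv_def using b by (intro sum.mono_neutral_right) (auto simp: const0_def biadditive_simps)
  then show "conv b f (const0 v) n = b (f n) v" by (simp add: const0_def)
qed

lemma const0_conv:
  assumes "biadditive b"
  shows "conv b (const0 v) g = (\<lambda>n. b v (g n))"
proof (rule ext)
  fix n
  have "conv b (const0 v) g n = (\<Sum>i\<in>{0}. b (const0 v i) (g (n - i)))"
    unfolding conv_def using assms by (intro sum.mono_neutral_right) (auto simp: const0_def biadditive_simps)
  then show "conv b (const0 v) g n = b v (g n)" by (simp add: const0_def)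
qed

lemma conv_antisym:
  fixes b :: "'a \<Rightarrow> 'a \<Rightarrow> 'b::ab_group_add"
  assumes "\<And>x y. b x y = - b y x"
  shows "conv b f g = - conv b g f"
proof (rule ext)
  fix n
  have "conv b f g n = (\<Sum>i\<le>n. b (f (n - i)) (g (n - (n - i))))"
    unfolding conv_def by (rule sum.nat_diff_reindex[symmetric, of _ "Suc n", simplified lessThan_Suc_atMost, simplified])
  also have "\<dots> = (\<Sum>i\<le>n. - b (g i) (f (n - i)))"
    by (intro sum.cong) (auto intro: assms)
  finally show "conv b f g n = (- conv b g f) n" by (simp add: conv_def sum_negf)
qed

lemma conv_shift:
  assumes "biadditive b"
  shows "conv b (shift f) g = shift (conv b f g)" "conv b f (shift g) = shift (conv b f g)"
proof -
  show "conv b (shift f) g = shift (conv b f g)"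
  proof (rule ext)
    fix n show "conv b (shift f) g n = shift (conv b f g) n"
      using assms by (cases n) (simp_all add: conv_def sum.atMost_Suc_shift biadditive_simps del: sum.atMost_Suc)
  qed
  show "conv b f (shift g) = shift (conv b f g)"
  proof (rule ext)
    fix n show "conv b f (shift g) n = shift (conv b f g) n"
      using assms by (cases n) (simp_all add: conv_def biadditive_simps Suc_diff_le)
  qed
qed

text \<open>Multiplication by t can be pulled out of either factor of \<open>conv\<close>, so the
  Leibniz rules of the two coefficients add up to one for the pencil.\<close>

lemma leibniz_lin_op:
  assumes b: "biadditive b" and Z: "additive Z0" "additive Z1"
    and L: "leibniz Z0 X0 Y0 b" "leibniz Z1 X1 Y1 b"
  shows "leibniz (lin_op Z0 Z1) (lin_op X0 X1) (lin_op Y0 Y1) (conv b)"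
  unfolding leibniz_def
proof (intro allI)
  fix f g
  have pt: "(\<lambda>n. Z (conv b f g n)) = conv b (\<lambda>i. X (f i)) g + conv b f (\<lambda>i. Y (g i))"
    if "additive Z" "leibniz Z X Y b" for Z X Y
    using that by (simp add: fun_eq_iff conv_def additive.sum leibniz_def sum.distrib)
  have sh: "shift (f + g) = shift f + shift g" for f g :: "nat \<Rightarrow> 'd::monoid_add"
    by (auto simp: fun_eq_iff shift_def split: nat.splits)
  show "lin_op Z0 Z1 (conv b f g) = conv b (lin_op X0 X1 f) g + conv b f (lin_op Y0 Y1 g)"
    unfolding lin_op_def pt[OF Z(1) L(1)] pt[OF Z(2) L(2)]
    by (simp add: biadditive_simps[OF biadditive_conv[OF b]] conv_shift[OF b] sh algebra_simps)
qed

text \<open>The commutator of d/dt with X0 + t X1 is X1; \<open>derivative_funpow\<close> starts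
  from such a commutator.\<close>

lemma fderiv_lin_op:
  assumes "additive X0" "additive X1"
  shows "fderiv (lin_op X0 X1 f) = lin_op X0 X1 (fderiv f) + (\<lambda>i. X1 (f i))"
proof (rule ext)
  fix n show "fderiv (lin_op X0 X1 f) n = (lin_op X0 X1 (fderiv f) + (\<lambda>i. X1 (f i))) n"
    using assms by (cases n) (simp_all add: fderiv_def lin_op_def nmul_Suc additive_nmul additive.add nmul_add_right algebra_simps)
qed

lemma fderiv_const0 [simp]: "fderiv (const0 v) = 0"
  by (simp add: fderiv_def const0_def fun_eq_iff)

lemma lin_op_funpow_0: "((lin_op X0 X1 ^^ n) f) 0 = (X0 ^^ n) (f 0)"
  by (induction n) (simp_all add: lin_op_def)

lemma lin_op_funpow_top:
  assumes "additive X0" "additive X1"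
  shows "n < i \<Longrightarrow> ((lin_op X0 X1 ^^ n) (const0 v)) i = 0"
    and "((lin_op X0 X1 ^^ n) (const0 v)) n = (X1 ^^ n) v"
proof -
  show *: "n < i \<Longrightarrow> ((lin_op X0 X1 ^^ n) (const0 v)) i = 0" for n i
  proof (induction n arbitrary: i)
    case (Suc n)
    then obtain m where "i = Suc m" by (cases i) auto
    with Suc show ?case
      using assms by (simp add: lin_op_def additive.zero)
  qed (simp add: const0_def)
  show "((lin_op X0 X1 ^^ n) (const0 v)) n = (X1 ^^ n) v"
    using assms by (induction n) (simp_all add: lin_op_def additive.zero * , simp add: const0_def)
qed

text \<open>Evaluation at t = 1, where the pencil becomes X0 + X1. The bound
  \<open>n \<le> N\<close> makes the sum run over all coefficients.\<close>

lemma sum_lin_op_funpow: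
  assumes "additive X0" "additive X1" "n \<le> N"
  shows "(\<Sum>i\<le>N. ((lin_op X0 X1 ^^ n) (const0 v)) i) = ((\<lambda>a. X0 a + X1 a) ^^ n) v"
  using assms(3)
proof (induction n)
  case 0
  then show ?case by (simp add: const0_def)
next
  case (Suc n)
  let ?f = "(lin_op X0 X1 ^^ n) (const0 v)"
  \<comment> \<open>Multiplying by t preserves the value at 1, as long as the coefficient of degree
    \<open>N\<close>, which the shift pushes out of the range, is zero.\<close>
  have sh: "(\<Sum>i\<le>N. shift (\<lambda>i. X1 (?f i)) i) = (\<Sum>i\<le>N. X1 (?f i))"
  proof -
    obtain M where M: "N = Suc M" using Suc.prems by (cases N) auto
    have "?f N = 0" by (rule lin_op_funpow_top) (use assms Suc.prems in auto)
    then have "(\<Sum>i\<le>N. X1 (?f i)) = (\<Sum>i\<le>M. X1 (?f i))"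
      using assms by (simp add: M additive.zero)
    then show ?thesis
      unfolding M by (subst sum.atMost_Suc_shift) simp
  qed
  have "(\<Sum>i\<le>N. ((lin_op X0 X1 ^^ Suc n) (const0 v)) i) = X0 (\<Sum>i\<le>N. ?f i) + X1 (\<Sum>i\<le>N. ?f i)"
    by (simp add: lin_op_def[of X0 X1 ?f] sum.distrib sh additive.sum[OF assms(1)] additive.sum[OF assms(2)])
  then show ?case using Suc by simp
qed

text \<open>Pascal's rule; the coefficients are those of the hockey-stick identity.\<close>
lemma derivative_funpow:
  assumes R: "additive R" and b: "biadditive b" and L: "leibniz R R Q b"
    and D: "\<And>f. D (R f) = R (D f) + b f u"
  shows "D ((R ^^ Suc n) v) = (R ^^ Suc n) (D v) + (\<Sum>m\<le>n. nmul (Suc n choose m) (b ((R ^^ m) v) ((Q ^^ (n - m)) u)))"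
proof (induction n)
  case 0
  show ?case by (simp add: D)
next
  case (Suc n)
  let ?b = "\<lambda>m l. b ((R ^^ m) v) ((Q ^^ l) u)"
  have "D ((R ^^ Suc (Suc n)) v) = (R ^^ Suc (Suc n)) (D v) + (R (\<Sum>m\<le>n. nmul (Suc n choose m) (?b m (n - m))) + ?b (Suc n) 0)"
    using Suc by (simp add: D[of "(R ^^ Suc n) v", simplified] additive.add[OF R] add.assoc)
  also have "R (\<Sum>m\<le>n. nmul (Suc n choose m) (?b m (n - m))) =
      (\<Sum>m\<le>n. nmul (Suc n choose m) (?b (Suc m) (n - m))) + (\<Sum>m\<le>n. nmul (Suc n choose m) (?b m (Suc n - m)))"
    using L by (simp add: additive.sum[OF R] additive_nmul[OF R] leibniz_def nmul_add_right sum.distrib Suc_diff_le)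
  also have "(\<Sum>m\<le>n. nmul (Suc n choose m) (?b m (Suc n - m))) =
     ?b 0 (Suc n) + (\<Sum>m<n. nmul (Suc n choose Suc m) (?b (Suc m) (n - m)))"
  proof (cases n)
    case 0 then show ?thesis by simp
  next
    case [simp]: (Suc k)
    show ?thesis
      by (subst sum.atMost_Suc_shift[of _ k, folded Suc]) (simp add: lessThan_Suc_atMost del: binomial_Suc_Suc funpow.simps)
  qed
  also have "(\<Sum>m\<le>n. nmul (Suc n choose m) (?b (Suc m) (n - m))) + \<dots> + ?b (Suc n) 0 =
     ?b 0 (Suc n) + (\<Sum>m\<le>n. nmul (Suc n choose m) (?b (Suc m) (n - m))) +
     (\<Sum>m\<le>n. nmul (Suc n choose Suc m) (?b (Suc m) (n - m)))"
    by (simp add: lessThan_Suc_atMost[symmetric] del: binomial_Suc_Suc funpow.simps)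
  also have "\<dots> = ?b 0 (Suc n) + (\<Sum>m\<le>n. nmul (Suc (Suc n) choose Suc m) (?b (Suc m) (n - m)))"
    by (subst binomial_Suc_Suc[of "Suc n"]) (simp add: nmul_add sum.distrib add.assoc del: funpow.simps binomial_Suc_Suc)
  also have "\<dots> = (\<Sum>m\<le>Suc n. nmul (Suc (Suc n) choose m) (?b m (Suc n - m)))"
    by (subst sum.atMost_Suc_shift) (simp del: funpow.simps binomial_Suc_Suc)
  finally show ?case by (simp only: )
qed

text \<open>At the exponent p every binomial coefficient in the sum, except the one for m = 0, is a
  multiple of p; a single summand is left.\<close>

lemma derivative_funpow_char:
  assumes "additive R" "biadditive b" "leibniz R R Q b" "\<And>f. D (R f) = R (D f) + b f u"
    and p: "prime p" "\<And>x y. nmul p (b x y) = 0"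
  shows "D ((R ^^ p) v) = (R ^^ p) (D v) + b v ((Q ^^ (p - 1)) u)"
proof -
  obtain n where n: "p = Suc n"
    using prime_gt_0_nat[OF p(1)] by (metis Suc_pred)
  have "(\<Sum>m\<le>n. nmul (p choose m) (b ((R ^^ m) v) ((Q ^^ (n - m)) u))) =
      (\<Sum>m\<in>{0}. nmul (p choose m) (b ((R ^^ m) v) ((Q ^^ (n - m)) u)))"
  proof (intro sum.mono_neutral_right ballI)
    fix m assume "m \<in> {..n} - {0}"
    then have "p dvd (p choose m)"
      using p(1) n by (intro dvd_choose_prime) auto
    then show "nmul (p choose m) (b ((R ^^ m) v) ((Q ^^ (n - m)) u)) = 0"
      using p(2) nmul_dvd by blast
  qed auto
  then show ?thesis
    using derivative_funpow[OF assms(1-4), of n v] by (simp add: n del: funpow.simps binomial_Suc_Suc)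
qed

section \<open>Jacobson's polynomial in a Lie algebra of characteristic \<open>p\<close>\<close>

lemma sum_fun_apply: "(\<Sum>i\<in>A. f i) x = (\<Sum>i\<in>A. f i x)"
  by (induction A rule: infinite_finite_induct) simp_all

lemma biadditive_antisym:
  assumes b: "biadditive b" "\<And>x. b x x = 0"
  shows "b x y = - b y x"
proof -
  have "b (x + y) (x + y) = b x y + b y x"
    unfolding biadditive_simps[OF b(1)] by (simp add: b(2))
  then show ?thesis by (simp add: b(2) eq_neg_iff_add_eq_0)
qed

text \<open>Closedness of the one-form in abstract form: \<open>D\<close> and \<open>E\<close> will
  be two partial derivatives. Both sides expand by \<open>derivative_funpow\<close>. Reversing one
  summation matches the terms, because \<open>b\<close> is antisymmetric and the neighbouring
  coefficients p-1 choose m and p-1 choose m+1 add up to p choose m+1, a multiple of p.\<close>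

lemma derivative_funpow_swap:
  assumes R: "additive R" and b: "biadditive b" "\<And>x y. b x y = - b y x" and L: "leibniz R R R b"
    and D: "\<And>f. D (R f) = R (D f) + b f u" "D v = 0"
    and E: "\<And>f. E (R f) = R (E f) + b f v" "E u = 0"
    and p: "prime p" "p > 2" "\<And>x y. nmul p (b x y) = 0"
  shows "D ((R ^^ (p - 1)) v) = E ((R ^^ (p - 1)) u)"
proof -
  obtain n where n: "p = Suc (Suc n)"
    using p(2) by (metis Suc_lessD less_imp_Suc_add numeral_2_eq_2 add_Suc)
  let ?b = "\<lambda>m. b ((R ^^ m) v) ((R ^^ (n - m)) u)"
  have *: "nmul (Suc n choose m) (?b m) = - nmul (Suc n choose (n - m)) (?b m)" if "m \<le> n" for m
  proof -
    have "p dvd (p choose Suc m)"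
      using that p n by (intro dvd_choose_prime) auto
    then have "nmul (p choose Suc m) (?b m) = 0"
      by (rule nmul_dvd[OF p(3)])
    moreover have "Suc n choose (n - m) = Suc n choose Suc m"
      using that by (subst binomial_symmetric) auto
    moreover have "p choose Suc m = (Suc n choose m) + (Suc n choose Suc m)"
      by (simp add: n)
    ultimately show ?thesis
      by (simp add: nmul_add eq_neg_iff_add_eq_0 del: binomial_Suc_Suc)
  qed
  have "E ((R ^^ Suc n) u) = (\<Sum>m\<le>n. nmul (Suc n choose m) (b ((R ^^ m) u) ((R ^^ (n - m)) v)))"
    unfolding derivative_funpow[OF R b(1) L E(1)] E(2) additive.zero[OF additive_funpow[OF R]] by simp
  also have "\<dots> = (\<Sum>m\<le>n. nmul (Suc n choose (n - m)) (b ((R ^^ (n - m)) u) ((R ^^ (n - (n - m))) v)))"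
    by (rule sum.nat_diff_reindex[symmetric, of _ "Suc n", simplified lessThan_Suc_atMost, simplified])
  also have "\<dots> = (\<Sum>m\<le>n. nmul (Suc n choose m) (?b m))"
  proof (intro sum.cong refl)
    fix m assume "m \<in> {..n}"
    then show "nmul (Suc n choose (n - m)) (b ((R ^^ (n - m)) u) ((R ^^ (n - (n - m))) v)) = nmul (Suc n choose m) (?b m)"
      using *[of m] b(2)[of "(R ^^ (n - m)) u" "(R ^^ m) v"] by (simp add: nmul_minus del: binomial_Suc_Suc)
  qed
  also have "\<dots> = D ((R ^^ Suc n) v)"
    unfolding derivative_funpow[OF R b(1) L D(1)] D(2) additive.zero[OF additive_funpow[OF R]] by simp
  finally show ?thesis by (simp add: n)
qed

locale lie_alg = vector_space s for s :: "'k::field_prime_char \<Rightarrow> 'v::ab_group_add \<Rightarrow> 'v" +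
  fixes br :: "'v \<Rightarrow> 'v \<Rightarrow> 'v"
  assumes biadditive_br: "biadditive br"
    and br_scale: "br (s c x) y = s c (br x y)"
    and br_self: "br x x = 0"
    and jacobi: "br (br x y) z + br (br y z) x + br (br z x) y = 0"
begin

lemma br_antisym: "br x y = - br y x"
  by (rule biadditive_antisym[OF biadditive_br br_self])

lemmas br_simps = biadditive_simps[OF biadditive_br]

lemma leibniz_br: "leibniz (\<lambda>v. br v y) (\<lambda>v. br v y) (\<lambda>v. br v y) br"
  unfolding leibniz_def
proof (intro allI)
  fix v w
  have "br (br v w) y = - br (br w y) v - br (br y v) w"
    using jacobi[of v w y] by (simp add: eq_neg_iff_add_eq_0 algebra_simps)
  then show "br (br v w) y = br (br v y) w + br v (br w y)"
    by (simp add: br_antisym[of "br w y" v] br_antisym[of y v] br_simps)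
qed

lemma additive_br: "additive (\<lambda>v. br v y)"
  by (rule biadditiveD[OF biadditive_br])

lemma nmul_char: "nmul CHAR('k) (x :: 'v) = 0"
  by (simp add: nmul_conv_scale)

text \<open>The operator v \<mapsto> [v, h + t g]. Brackets are taken on the right to agree with
  left-normed words.\<close>

definition ad_poly :: "'v \<Rightarrow> 'v \<Rightarrow> (nat \<Rightarrow> 'v) \<Rightarrow> nat \<Rightarrow> 'v" where
  "ad_poly h g = lin_op (\<lambda>v. br v h) (\<lambda>v. br v g)"

text \<open>Jacobson's polynomial: in an associative algebra \<open>jac g h = (g + h)\<^sup>p - g\<^sup>p - h\<^sup>p\<close>.
  It is the integral from \<open>0\<close> to \<open>1\<close> of \<open>[g, x, \<dots>, x]\<close> at \<open>x = h + t g\<close>.\<close>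
definition jac :: "'v \<Rightarrow> 'v \<Rightarrow> 'v" where
  "jac g h = (\<Sum>i<CHAR('k) - 1. s (1 / of_nat (Suc i)) ((ad_poly h g ^^ (CHAR('k) - 1)) (const0 g) i))"

lemma additive_ad_poly: "additive (ad_poly h g)"
  unfolding ad_poly_def by (intro additive_lin_op additive_br)

lemma leibniz_ad_poly: "leibniz (ad_poly h g) (ad_poly h g) (ad_poly h g) (conv br)"
  unfolding ad_poly_def by (intro leibniz_lin_op biadditive_br additive_br leibniz_br)

text \<open>\<open>B k u g\<close> brackets with k + s u + t g on polynomials in two variables;
  exchanging the variables exchanges u and g.\<close>

lemma ad_poly_pencil:
  fixes f :: "nat \<Rightarrow> nat \<Rightarrow> 'v" and k u g :: 'v
  defines "B \<equiv> \<lambda>k u g. lin_op (ad_poly k g) (\<lambda>f j. br (f j) u)"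
  shows "B k g u (\<lambda>i j. f j i) = (\<lambda>i j. B k u g f j i)"
proof (intro ext)
  fix i j
  show "B k g u (\<lambda>i j. f j i) i j = B k u g f j i"
    by (cases i; cases j) (simp_all add: B_def ad_poly_def lin_op_def algebra_simps)
qed

text \<open>Stokes' theorem on the unit square for the closed one-form at x = k + s u + t g. The
  left side compares the integrals along the sides s = 1 and s = 0, the right side those along t = 1
  and t = 0.\<close>

lemma jac_swap:
  assumes p: "CHAR('k) > 2"
  shows "jac g (k + u) - jac g k = jac u (k + g) - jac u k"
proof -
  let ?p = "CHAR('k)" and ?n = "CHAR('k) - 1"
  \<comment> \<open>The outer index counts powers of s, the inner one powers of t.\<close>
  define B where "B k u g = lin_op (ad_poly k g) (\<lambda>f j. br (f j) u)" for k u g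
  define cc where "cc v = const0 (const0 v)" for v :: 'v
  have ptadd: "additive (\<lambda>f j. br (f j) u)" for u :: 'v and f :: "nat \<Rightarrow> 'v"
    by (simp add: additive_def fun_eq_iff br_simps)
  \<comment> \<open>Setting s = 1 replaces k by k + u; \<open>B0\<close> is the case s = 0.\<close>
  have sumB: "(\<Sum>i\<le>?n. (B k u g ^^ ?n) (cc v) i j) = (ad_poly (k + u) g ^^ ?n) (const0 v) j" for k u g v j
  proof -
    have "(\<Sum>i\<le>?n. (B k u g ^^ ?n) (cc v) i) = ((\<lambda>a. ad_poly k g a + (\<lambda>j. br (a j) u)) ^^ ?n) (const0 v)"
      unfolding B_def cc_def by (intro sum_lin_op_funpow additive_ad_poly ptadd) auto
    also have "(\<lambda>a. ad_poly k g a + (\<lambda>j. br (a j) u)) = ad_poly (k + u) g"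
      by (auto simp: fun_eq_iff ad_poly_def lin_op_def br_simps algebra_simps)
    finally show ?thesis by (simp add: fun_eq_iff sum_fun_apply)
  qed
  have B0: "(B k u g ^^ ?n) (cc v) 0 = (ad_poly k g ^^ ?n) (const0 v)" for k u g v
    by (simp add: B_def lin_op_funpow_0) (simp add: cc_def const0_def)
  have Btop: "(B k u g ^^ ?n) (cc v) i = 0" if "i > ?n" for k u g v i
    unfolding B_def cc_def by (intro lin_op_funpow_top additive_ad_poly ptadd that)
  have swap: "(B k g u ^^ n) (cc v) i j = (B k u g ^^ n) (cc v) j i" for k u g v i j n
  proof -
    have "(B k g u ^^ n) (cc v) = (\<lambda>i j. (B k u g ^^ n) (cc v) j i)"
    proof (induction n)
      case (Suc n)
      then show ?case
        using ad_poly_pencil[of k u g "(B k u g ^^ n) (cc v)"] by (simp add: B_def)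
    qed (auto simp: cc_def const0_def fun_eq_iff)
    then show ?thesis by simp
  qed
  define a b where "a = (B k u g ^^ ?n) (cc g)" and "b = (B k u g ^^ ?n) (cc u)"
  \<comment> \<open>The derivative by s of the component \<open>a\<close> in direction g equals the
    derivative by t of the component \<open>b\<close> in direction u.\<close>
  have closed: "fderiv a = (\<lambda>i. fderiv (b i))"
    unfolding a_def b_def
  proof (rule derivative_funpow_swap[where b = "conv (conv br)" and E = "\<lambda>f i. fderiv (f i)"])
    show "additive (B k u g)"
      unfolding B_def by (intro additive_lin_op additive_ad_poly ptadd)
    show bi: "biadditive (conv (conv br))"
      by (intro biadditive_conv biadditive_br)
    show "conv (conv br) x y = - conv (conv br) y x" for x y
      by (intro conv_antisym br_antisym)
    have "leibniz (\<lambda>f j. br (f j) u) (\<lambda>f j. br (f j) u) (\<lambda>f j. br (f j) u) (conv br)"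
      using leibniz_br[of u] by (auto simp: leibniz_def conv_def fun_eq_iff additive.sum[OF additive_br] sum.distrib)
    then show "leibniz (B k u g) (B k u g) (B k u g) (conv (conv br))"
      unfolding B_def
      by (intro leibniz_lin_op biadditive_conv biadditive_br additive_ad_poly ptadd leibniz_ad_poly)
    have cc: "conv (conv br) f (cc w) = (\<lambda>i j. br (f i j) w)" for f w
      by (simp add: cc_def conv_const0 biadditive_conv biadditive_br)
    show "fderiv (B k u g f) = B k u g (fderiv f) + conv (conv br) f (cc u)" for f
      unfolding cc B_def by (intro fderiv_lin_op additive_ad_poly ptadd)
    show "(\<lambda>i. fderiv (B k u g f i)) = B k u g (\<lambda>i. fderiv (f i)) + conv (conv br) f (cc g)" for f
    proof (intro ext)
      fix i j
      have 1: "fderiv (\<lambda>j. br (h j) u) = (\<lambda>j. br (fderiv h j) u)" for h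
        by (simp add: fderiv_def fun_eq_iff additive_nmul[OF additive_br])
      have 2: "fderiv (x + y) = fderiv x + fderiv y" for x y :: "nat \<Rightarrow> 'v"
        by (simp add: fderiv_def fun_eq_iff nmul_add_right)
      have 3: "fderiv (ad_poly k g h) = ad_poly k g (fderiv h) + (\<lambda>i. br (h i) g)" for h
        unfolding ad_poly_def by (intro fderiv_lin_op additive_br)
      show "fderiv (B k u g f i) j = (B k u g (\<lambda>i. fderiv (f i)) + conv (conv br) f (cc g)) i j"
        unfolding cc B_def lin_op_def[of "ad_poly k g"] by (cases i) (simp_all add: 1 2 3 algebra_simps)
    qed
    show "prime ?p" "?p > 2" by (use p in auto)
    show "nmul ?p (conv (conv br) x y) = 0" for x y
      by (simp add: nmul_fun nmul_char fun_eq_iff)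
  qed (auto simp: cc_def const0_def fderiv_def fun_eq_iff)
  \<comment> \<open>Closedness coefficient by coefficient, divided by (i+1)(j+1); both factors are
    invertible because they are below p.\<close>
  have bSuc: "s (1 / of_nat (Suc j)) (a (Suc i) j) = s (1 / of_nat (Suc i)) (b i (Suc j))"
    if "i < ?n" "j < ?n" for i j
  proof -
    have nz: "of_nat (Suc i) \<noteq> (0 :: 'k)" "of_nat (Suc j) \<noteq> (0 :: 'k)"
      unfolding of_nat_eq_0_iff_char_dvd using that by (auto dest!: dvd_imp_le)
    have "s (of_nat (Suc i)) (a (Suc i) j) = s (of_nat (Suc j)) (b i (Suc j))"
      using fun_cong[OF fun_cong[OF closed]] by (simp add: fderiv_def nmul_conv_scale nmul_fun del: of_nat_Suc)
    then have "s (1 / (of_nat (Suc i) * of_nat (Suc j))) (s (of_nat (Suc i)) (a (Suc i) j)) =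
        s (1 / (of_nat (Suc i) * of_nat (Suc j))) (s (of_nat (Suc j)) (b i (Suc j)))" by simp
    then show ?thesis using nz by (simp del: of_nat_Suc)
  qed
  have n: "{..?n} = insert 0 (Suc ` {..<?n})"
    unfolding lessThan_Suc_atMost[symmetric] by (rule lessThan_Suc_eq_insert_0)
  have split: "(\<Sum>i\<le>?n. h i) = h 0 + (\<Sum>i<?n. h (Suc i))" for h :: "nat \<Rightarrow> 'v"
    unfolding n by (subst sum.insert) (auto simp: sum.reindex)
  \<comment> \<open>The part of degree 0 in s is exactly \<open>jac g k\<close> and cancels.\<close>
  have "jac g (k + u) - jac g k = (\<Sum>j<?n. s (1 / of_nat (Suc j)) (\<Sum>i<?n. a (Suc i) j))"
    unfolding jac_def sumB[symmetric] B0[symmetric] split a_def[symmetric]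
    by (simp add: a_def B0[simplified] scale_right_distrib sum.distrib)
  also have "\<dots> = (\<Sum>j<?n. \<Sum>i<?n. s (1 / of_nat (Suc i)) (b i (Suc j)))"
    using bSuc by (simp add: scale_sum_right)
  also have "\<dots> = (\<Sum>i<?n. s (1 / of_nat (Suc i)) (\<Sum>j<?n. b i (Suc j)))"
    by (subst sum.swap) (simp add: scale_sum_right)
  also have "\<dots> = jac u (k + g) - jac u k"
    unfolding jac_def sumB[symmetric] B0[of k g u, symmetric] split 
    by (simp add: swap[of _ k g u] b_def B0[simplified] scale_right_distrib sum.distrib)
  finally show ?thesis .
qed

text \<open>The first bracket [g, h + t g] is already zero.\<close>

lemma jac_commuting:
  assumes "br g h = 0"
  shows "jac g h = 0"
proof -
  obtain n where n: "CHAR('k) - 1 = Suc n"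
    using prime_gt_1_nat[OF CHAR_prime[where 'a = 'k]] by (metis Suc_diff_Suc One_nat_def)
  have "ad_poly h g (const0 g) = 0"
    by (auto simp: assms ad_poly_def lin_op_def fun_eq_iff const0_def br_simps br_self shift_def split: nat.splits)
  then have "(ad_poly h g ^^ Suc n) (const0 g) = 0"
    using additive.zero[OF additive_funpow[OF additive_ad_poly]] by (simp add: funpow_swap1)
  then show ?thesis unfolding jac_def n by (simp del: funpow.simps of_nat_Suc)
qed

lemma jac_commute: "CHAR('k) > 2 \<Longrightarrow> jac g h = jac h g"
  using jac_swap[of g 0 h] by (simp add: jac_commuting br_simps)

text \<open>The symmetry of \<open>jac\<close> turns \<open>jac_swap\<close> into the cocycle
  identity of the additive group.\<close>

lemma jac_cocycle:
  assumes "CHAR('k) > 2"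
  shows "jac x y + jac (x + y) z = jac y z + jac x (y + z)"
proof -
  have "jac z (y + x) = jac (x + y) z" "jac z y = jac y z"
    using jac_commute[OF assms, of z] by (simp_all add: add.commute[of y x])
  then show ?thesis
    using jac_swap[OF assms, of x y z] by (simp add: algebra_simps)
qed

end

section \<open>Left-normed words for an arbitrary bracket\<close>

definition word :: "('v \<Rightarrow> 'v \<Rightarrow> 'v) \<Rightarrow> (nat \<Rightarrow> 'v) \<Rightarrow> nat \<Rightarrow> 'v" where
  "word br c n = foldl br (c 1) (map c [2..<Suc n])"

lemma word_1 [simp]: "word br c (Suc 0) = c 1"
  by (simp add: word_def)

lemma word_Suc [simp]: "n \<ge> 1 \<Longrightarrow> word br c (Suc n) = br (word br c n) (c (Suc n))"
  by (simp add: word_def)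

lemma word_cong: "(\<And>i. 1 \<le> i \<Longrightarrow> i \<le> n \<Longrightarrow> c i = d i) \<Longrightarrow> n \<ge> 1 \<Longrightarrow> word br c n = word br d n"
  unfolding word_def by (intro arg_cong2[where f = "foldl br"] map_cong) auto

context lie_alg
begin

text \<open>Induction on the length: appending h or g is one application of \<open>ad_poly\<close>,
  and the power of t counts the choices of g. The second letter can be fixed as h because [g, g] =
  0. The weight \<open>w\<close> is kept general since choosing g shifts it by one.\<close>

lemma sum_words:
  assumes "n \<ge> 2"
  shows "(\<Sum>S\<in>Pow {3..n}. s (w (card S)) (word br (factor S g h) n)) =
    (\<Sum>i<n - 1. s (w i) ((ad_poly h g ^^ (n - 1)) (const0 g) i))"
  using assms
proof (induction n arbitrary: w rule: dec_induct)
  case base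
  show ?case
    by (simp add: numeral_2_eq_2 factor_def ad_poly_def lin_op_def const0_def)
next
  case (step n)
  let ?a = "(ad_poly h g ^^ (n - 1)) (const0 g)"
  define W where "W S = word br (factor S g h) n" for S
  have W: "word br (factor S g h) (Suc n) = br (W S) h"
    "word br (factor (insert (Suc n) S) g h) (Suc n) = br (W S) g" if "S \<subseteq> {3..n}" for S
  proof -
    have "Suc n \<notin> S" using that by auto
    then show "word br (factor S g h) (Suc n) = br (W S) h"
      using step by (simp add: W_def factor_def[of S g h "Suc n"])
    have "word br (factor (insert (Suc n) S) g h) n = W S"
      unfolding W_def using step by (intro word_cong) (auto simp: factor_def)
    then show "word br (factor (insert (Suc n) S) g h) (Suc n) = br (W S) g"
      using step by (simp add: factor_def[of "insert (Suc n) S" g h "Suc n"])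
  qed
  have "{3..Suc n} = insert (Suc n) {3..n}"
    using step by auto
  then have P: "Pow {3..Suc n} = Pow {3..n} \<union> insert (Suc n) ` Pow {3..n}"
    by (simp only: Pow_insert)
  have inj: "inj_on (insert (Suc n)) (Pow {3..n})"
  proof (rule inj_onI)
    fix S T assume "S \<in> Pow {3..n}" "T \<in> Pow {3..n}" "insert (Suc n) S = insert (Suc n) T"
    moreover from this have "Suc n \<notin> S" "Suc n \<notin> T" by auto
    ultimately show "S = T" by (simp add: insert_ident)
  qed
  have "(\<Sum>S\<in>Pow {3..Suc n}. s (w (card S)) (word br (factor S g h) (Suc n))) =
     (\<Sum>S\<in>Pow {3..n}. s (w (card S)) (word br (factor S g h) (Suc n))) +
     (\<Sum>S\<in>Pow {3..n}. s (w (card (insert (Suc n) S))) (word br (factor (insert (Suc n) S) g h) (Suc n)))"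
    unfolding P by (subst sum.union_disjoint) (auto simp: sum.reindex[OF inj])
  also have "\<dots> = (\<Sum>S\<in>Pow {3..n}. s (w (card S)) (br (W S) h)) +
     (\<Sum>S\<in>Pow {3..n}. s (w (Suc (card S))) (br (W S) g))"
  proof (intro arg_cong2[where f = "(+)"] sum.cong refl)
    fix S assume "S \<in> Pow {3..n}"
    then have S: "S \<subseteq> {3..n}" "finite S" "Suc n \<notin> S"
      using finite_subset by auto
    then show "s (w (card S)) (word br (factor S g h) (Suc n)) = s (w (card S)) (br (W S) h)"
      "s (w (card (insert (Suc n) S))) (word br (factor (insert (Suc n) S) g h) (Suc n)) = s (w (Suc (card S))) (br (W S) g)"
      using W[OF S(1)] by simp_all
  qed
  also have "\<dots> = br (\<Sum>S\<in>Pow {3..n}. s (w (card S)) (W S)) h + br (\<Sum>S\<in>Pow {3..n}. s (w (Suc (card S))) (W S)) g"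
    by (simp add: additive.sum[OF additive_br] br_scale)
  also have "\<dots> = (\<Sum>i<n - 1. s (w i) (br (?a i) h)) + (\<Sum>i<n - 1. s (w (Suc i)) (br (?a i) g))"
    unfolding W_def step.IH step.IH[of "\<lambda>i. w (Suc i)"]
    by (simp add: additive.sum[OF additive_br] br_scale)
  \<comment> \<open>The coefficient of degree n - 1 is [g, g, ..., g] = 0, so one more summand may
    be included.\<close>
  also have "(\<Sum>i<n - 1. s (w i) (br (?a i) h)) = (\<Sum>i<Suc (n - 1). s (w i) (br (?a i) h))"
  proof -
    have "?a (n - 1) = ((\<lambda>v. br v g) ^^ (n - 1)) g"
      unfolding ad_poly_def by (intro lin_op_funpow_top additive_br)
    also have "n - 1 = Suc (n - 2)" using step by simp
    then have "((\<lambda>v. br v g) ^^ (n - 1)) g = 0"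
      using additive.zero[OF additive_funpow[OF additive_br], of "n - 2"]
      by (simp add: funpow_Suc_right br_self del: funpow.simps(2))
    finally have "?a (n - 1) = 0" .
    then show ?thesis by (simp add: br_simps)
  qed
  also have "(\<Sum>i<n - 1. s (w (Suc i)) (br (?a i) g)) = (\<Sum>i<Suc (n - 1). s (w i) (shift (\<lambda>i. br (?a i) g) i))"
    by (subst sum.lessThan_Suc_shift) simp
  also have "(\<Sum>i<Suc (n - 1). s (w i) (br (?a i) h)) + (\<Sum>i<Suc (n - 1). s (w i) (shift (\<lambda>i. br (?a i) g) i)) =
      (\<Sum>i<Suc (n - 1). s (w i) (ad_poly h g ?a i))"
    unfolding ad_poly_def lin_op_def by (simp only: plus_fun_apply scale_right_distrib sum.distrib)
  also have "\<dots> = (\<Sum>i<Suc n - 1. s (w i) ((ad_poly h g ^^ (Suc n - 1)) (const0 g) i))"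
  proof -
    obtain m where "n = Suc m" using step by (cases n) auto
    then show ?thesis by simp
  qed
  finally show ?case .
qed

text \<open>The factor 1/#(g) of the star property is the 1/(i+1) from integrating t^i: the fixed
  first letter g raises the count i by one.\<close>

lemma jac_conv_words:
  "jac g h = (\<Sum>S\<in>Pow {3..CHAR('k)}. s (1 / of_nat (card (insert 1 S))) (word br (factor S g h) CHAR('k)))"
proof -
  have "card (insert 1 S) = Suc (card S)" if "S \<in> Pow {3..CHAR('k)}" for S :: "nat set"
    using that finite_subset[of S "{3..CHAR('k)}"] by (subst card_insert_disjoint) auto
  then have "(\<Sum>S\<in>Pow {3..CHAR('k)}. s (1 / of_nat (card (insert 1 S))) (word br (factor S g h) CHAR('k))) =
     (\<Sum>S\<in>Pow {3..CHAR('k)}. s (1 / of_nat (Suc (card S))) (word br (factor S g h) CHAR('k)))"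
    by (intro sum.cong refl) metis
  also have "\<dots> = jac g h"
    unfolding jac_def using prime_ge_2_nat[OF CHAR_prime[where 'a = 'k]]
    by (rule sum_words[of _ "\<lambda>i. 1 / of_nat (Suc i)"])
  finally show ?thesis ..
qed

text \<open>The commutator of bracketing with w and bracketing with y is bracketing with -[w, y], so
  \<open>derivative_funpow_char\<close> yields the Leibniz rule for the p-th power of a
  derivation.\<close>

lemma br_funpow_char:
  defines "R \<equiv> \<lambda>y v. br v y"
  shows "(R y ^^ CHAR('k)) (br v w) = br ((R y ^^ CHAR('k)) v) w + br v ((R y ^^ CHAR('k)) w)"
proof -
  have L: "leibniz (R y) (R y) (R y) br" and R: "additive (R y)"
    unfolding R_def by (rule leibniz_br additive_br)+
  obtain n where n: "CHAR('k) = Suc n"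
    using prime_gt_0_nat[OF CHAR_prime[where 'a = 'k]] by (metis Suc_pred)
  have "br ((R y ^^ CHAR('k)) v) w = (R y ^^ CHAR('k)) (br v w) + br v ((R y ^^ (CHAR('k) - 1)) (- R y w))"
    by (rule derivative_funpow_char[OF R biadditive_br L, where D = "\<lambda>v. br v w"])
      (use L in \<open>simp_all add: leibniz_def br_simps nmul_char\<close>)
  also have "(R y ^^ (CHAR('k) - 1)) (- R y w) = - (R y ^^ CHAR('k)) w"
    using additive.minus[OF additive_funpow[OF R]] by (simp add: n funpow_swap1)
  finally show ?thesis by (simp add: br_simps)
qed

end

section \<open>The Witt algebra as a Lie algebra\<close>

lemma witt_eqI: "(\<And>f. Rep_witt g f = Rep_witt h f) \<Longrightarrow> g = h"
  by (metis Rep_witt_inject ext)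

interpretation witt: lie_alg witt_scale witt_bracket
proof (unfold_locales, goal_cases)
  case 1
  then show ?case unfolding biadditive_def
    by (transfer, simp add: fun_eq_iff is_derivation_iff)
next
  case (2 c x y)
  then show ?case
    by (transfer, simp add: fun_eq_iff is_derivation_iff trunc_vs.scale_right_diff_distrib)
next
  case (3 x)
  then show ?case by (transfer, simp)
next
  case (4 x y z)
  then show ?case
  proof transfer
    fix x y z :: "'a trunc_poly \<Rightarrow> 'a trunc_poly"
    assume "is_derivation x" "is_derivation y" "is_derivation z"
    then have "additive x" "additive y" "additive z"
      by (auto simp: is_derivation_iff additive_def)
    then show "(\<lambda>f. x (y (z f)) - y (x (z f)) - z (x (y f) - y (x f)) + (y (z (x f)) - z (y (x f)) - x (y (z f) - z (y f))) +
             (z (x (y f)) - x (z (y f)) - y (z (x f) - x (z f)))) = (\<lambda>_. 0)"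
      by (simp add: additive.diff)
  qed
qed

section \<open>Cocycles as Lie algebra extensions\<close>

lemma CHAR_SucE:
  obtains n where "CHAR('k::field_prime_char) = Suc n" "n \<noteq> 0"
proof (cases "CHAR('k)")
  case (Suc n)
  then show ?thesis
    using that prime_gt_1_nat[OF CHAR_prime[where 'a = 'k]] by auto
qed auto

lemma iter_bracket_conv_word: "iter_bracket = word witt_bracket"
  by (simp add: fun_eq_iff word_def iter_bracket_def)

lemma iter_bracket_funpow:
  "iter_bracket (\<lambda>i. if i = Suc 0 then g else h) (Suc n) = ((\<lambda>v. witt_bracket v h) ^^ n) g"
  by (induction n) (simp_all add: iter_bracket_conv_word)

lemma (in lie_alg) br_scale_right: "br x (s c y) = s c (br x y)"
  using br_scale[of c y x] br_antisym[of x "s c y"] br_antisym[of x y] by simp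

lemma (in lie_alg) word_scale:
  "n \<ge> 1 \<Longrightarrow> word br (\<lambda>i. s c (d i)) n = s (c ^ n) (word br d n)"
  by (induction n rule: dec_induct) (simp_all add: br_scale br_scale_right mult.commute)

text \<open>Every word in the sum has exactly p letters.\<close>

lemma (in lie_alg) jac_scale: "jac (s c g) (s c h) = s (c ^ CHAR('k)) (jac g h)"
proof -
  have "factor S (s c g) (s c h) = (\<lambda>i. s c (factor S g h i))" for S
    by (auto simp: factor_def fun_eq_iff)
  moreover have "CHAR('k) \<ge> 1"
    by (rule CHAR_SucE[where 'k = 'k]) simp
  ultimately show ?thesis
    unfolding jac_conv_words by (simp add: word_scale scale_sum_right mult.commute)
qed

text \<open>Together with \<open>ext_bracket\<close>, the Lie algebra part of
  \<open>central_extension\<close>, detached from \<omega> so that it fits the locale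
  \<open>lie_alg\<close>.\<close>

definition ext_scale :: "'k \<Rightarrow> 'k::field_prime_char witt \<times> 'k \<Rightarrow> 'k witt \<times> 'k" where
  "ext_scale c x = (witt_scale c (fst x), c * snd x)"

definition ext_bracket ::
  "('k::field_prime_char witt \<Rightarrow> 'k witt \<Rightarrow> 'k) \<Rightarrow> 'k witt \<times> 'k \<Rightarrow> 'k witt \<times> 'k \<Rightarrow> 'k witt \<times> 'k" where
  "ext_bracket \<phi> x y = (witt_bracket (fst x) (fst y), \<phi> (fst x) (fst y))"

definition lie_cocycle :: "('k::field_prime_char witt \<Rightarrow> 'k witt \<Rightarrow> 'k) \<Rightarrow> bool" where
  "lie_cocycle \<phi> \<longleftrightarrow> \<phi> \<in> cl_cochain2 \<and> cl_delta2 \<phi> = 0"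

lemma cl_cochain2D:
  assumes "\<phi> \<in> cl_cochain2"
  shows "biadditive \<phi>" "\<phi> (witt_scale c g) h = c * \<phi> g h" "\<phi> g (witt_scale c h) = c * \<phi> g h"
    "\<phi> g g = 0" "\<phi> g h = - \<phi> h g"
proof -
  show *: "biadditive \<phi>" "\<phi> g g = 0" for g
    using assms by (auto simp: cl_cochain2_def linear_witt_iff biadditive_def)
  show "\<phi> g h = - \<phi> h g"
    using * by (rule biadditive_antisym)
qed (use assms in \<open>auto simp: cl_cochain2_def linear_witt_iff\<close>)

text \<open>The central component of the Jacobi identity is the cocycle condition on \<phi>.\<close>

lemma lie_alg_ext:
  assumes "lie_cocycle \<phi>"
  shows "lie_alg ext_scale (ext_bracket \<phi>)"
proof
  have c: "\<phi> \<in> cl_cochain2" and d: "\<phi> (witt_bracket x y) z - \<phi> (witt_bracket x z) y + \<phi> (witt_bracket y z) x = 0" for x y z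
    using assms by (auto simp: lie_cocycle_def cl_delta2_def fun_eq_iff)
  note \<phi> = cl_cochain2D(2-4)[OF c] biadditive_simps[OF cl_cochain2D(1)[OF c]]
  show "biadditive (ext_bracket \<phi>)"
    by (simp add: biadditive_def ext_bracket_def \<phi> witt.br_simps)
  show "ext_bracket \<phi> (ext_scale a x) y = ext_scale a (ext_bracket \<phi> x y)" for a x y
    by (simp add: ext_bracket_def ext_scale_def \<phi> witt.br_scale)
  show "ext_bracket \<phi> x x = 0" for x
    by (simp add: ext_bracket_def \<phi> witt.br_self zero_prod_def)
  show "ext_bracket \<phi> (ext_bracket \<phi> x y) z + ext_bracket \<phi> (ext_bracket \<phi> y z) x +
    ext_bracket \<phi> (ext_bracket \<phi> z x) y = 0" for x y z
    using d[of "fst x" "fst y" "fst z"] witt.jacobi[of "fst x" "fst y" "fst z"]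
    by (simp add: ext_bracket_def zero_prod_def witt.br_antisym[of "fst z" "fst x"] \<phi> algebra_simps)
qed (simp_all add: ext_scale_def witt_vs.scale_right_distrib witt_vs.scale_left_distrib algebra_simps prod_eq_iff)

text \<open>The central part of a word in the extension comes from its last bracket alone: it is
  \<phi> of the word without its last letter and of that letter. This transfers the properties of
  \<open>jac\<close> to the star sum.\<close>

lemma star_sum_conv_jac:
  assumes "lie_cocycle (\<phi> :: 'k::field_prime_char witt \<Rightarrow> _)"
  shows "star_sum \<phi> g h = snd (lie_alg.jac ext_scale (ext_bracket \<phi>) (g, 0) (h, 0))"
proof -
  let ?p = "CHAR('k)"
  have w: "word (ext_bracket \<phi>) (factor S (g, 0) (h, 0)) (Suc n) =
      (iter_bracket (factor S g h) (Suc n), if n = 0 then 0 else \<phi> (iter_bracket (factor S g h) n) (factor S g h (Suc n)))" for S n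
  proof (induction n)
    case 0
    then show ?case by (simp add: factor_def iter_bracket_conv_word)
  next
    case (Suc n)
    have "fst (factor S (g, 0 :: 'k) (h, 0) i) = factor S g h i" for i
      by (simp add: factor_def)
    with Suc show ?case
      by (simp add: ext_bracket_def iter_bracket_conv_word)
  qed
  obtain n where n: "?p = Suc n" "n \<noteq> 0"
    by (rule CHAR_SucE)
  have sc: "snd (ext_scale c x) = c * snd x" for c :: 'k and x
    by (simp add: ext_scale_def)
  show ?thesis
    unfolding lie_alg.jac_conv_words[OF lie_alg_ext[OF assms]] star_sum_def
    by (simp add: n w snd_sum sc)
qed

context
  fixes \<phi> :: "'k::field_prime_char witt \<Rightarrow> 'k witt \<Rightarrow> 'k"
  assumes \<phi>: "lie_cocycle \<phi>"
begin

interpretation ext: lie_alg ext_scale "ext_bracket \<phi>"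
  by (rule lie_alg_ext[OF \<phi>])

lemma star_sum_commute: "CHAR('k) > 2 \<Longrightarrow> star_sum \<phi> g h = star_sum \<phi> h g"
  by (simp add: star_sum_conv_jac[OF \<phi>] ext.jac_commute)

lemma star_sum_cocycle:
  assumes "CHAR('k) > 2"
  shows "star_sum \<phi> x y + star_sum \<phi> (x + y) z = star_sum \<phi> y z + star_sum \<phi> x (y + z)"
  using ext.jac_cocycle[OF assms, of "(x, 0)" "(y, 0)" "(z, 0)"]
  unfolding star_sum_conv_jac[OF \<phi>] by (simp add: prod_eq_iff)

lemma star_sum_homogeneous:
  "star_sum \<phi> (witt_scale c g) (witt_scale c h) = c ^ CHAR('k) * star_sum \<phi> g h"
  using ext.jac_scale[of c "(g, 0)" "(h, 0)"]
  unfolding star_sum_conv_jac[OF \<phi>] by (simp add: ext_scale_def prod_eq_iff)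

lemma star_sum_commuting:
  "witt_bracket g h = 0 \<Longrightarrow> \<phi> g h = 0 \<Longrightarrow> star_sum \<phi> g h = 0"
  unfolding star_sum_conv_jac[OF \<phi>]
  by (subst ext.jac_commuting) (simp_all add: ext_bracket_def zero_prod_def)

end

section \<open>The p-map of the Witt algebra and Jacobson's formula\<close>

lemma additive_Rep_witt: "additive (Rep_witt g)" "additive (\<lambda>g. Rep_witt g a)"
  using Rep_witt[of g] by (auto simp: additive_def is_derivation_iff plus_witt.rep_eq)

lemmas Rep_witt_simps = plus_witt.rep_eq minus_witt.rep_eq uminus_witt.rep_eq zero_witt.rep_eq
  witt_scale.rep_eq witt_bracket.rep_eq witt_pmap.rep_eq

lemma funpow_uminus:
  fixes D :: "'a::ab_group_add \<Rightarrow> 'a"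
  assumes "additive D" "odd n"
  shows "((\<lambda>a. - D a) ^^ n) a = - (D ^^ n) a"
proof -
  have "((\<lambda>a. - D a) ^^ n) a = (if even n then (D ^^ n) a else - (D ^^ n) a)" for n
    by (induction n) (simp_all add: additive.minus[OF assms(1)])
  then show ?thesis using assms(2) by simp
qed

text \<open>With the minus sign \<open>A\<close> becomes a right module over \<open>W\<close>, in
  step with the right brackets of \<open>ad_poly\<close>.\<close>

lemma leibniz_Rep_witt:
  "leibniz (\<lambda>a. - Rep_witt h a) (\<lambda>a. - Rep_witt h a) (\<lambda>w. witt_bracket w h) (\<lambda>a w. - Rep_witt w a)"
  by (simp add: leibniz_def Rep_witt_simps additive.minus[OF additive_Rep_witt(1)])

lemma biadditive_Rep_witt: "biadditive (\<lambda>a w. - Rep_witt w a)"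
  by (simp add: biadditive_def additive.add[OF additive_Rep_witt(1)] additive.add[OF additive_Rep_witt(2)])

text \<open>This is \<open>derivative_funpow_char\<close> for the p-th power of the right action of
  h, with the operator g as \<open>D\<close>. Since p is odd, the sign of the right action survives
  the p-th power.\<close>

lemma ad_witt_pmap:
  fixes g h :: "'k::field_prime_char witt"
  assumes p: "CHAR('k) > 2"
  shows "((\<lambda>v. witt_bracket v h) ^^ CHAR('k)) g = witt_bracket g (witt_pmap h)"
proof (rule witt_eqI)
  fix a
  let ?R = "\<lambda>a. - Rep_witt h a" and ?Q = "\<lambda>v. witt_bracket v h" and ?p = "CHAR('k)"
  have odd: "odd ?p" using p prime_odd_nat[OF CHAR_prime[where 'a = 'k]] by auto
  obtain n where n: "?p = Suc n" using odd by (cases ?p) auto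
  have "Rep_witt g ((?R ^^ ?p) a) = (?R ^^ ?p) (Rep_witt g a) + - Rep_witt ((?Q ^^ (?p - 1)) (?Q g)) a"
  proof (rule derivative_funpow_char[where b = "\<lambda>a w. - Rep_witt w a", OF _ biadditive_Rep_witt leibniz_Rep_witt])
    show "additive ?R"
      using additive_Rep_witt(1)[of h] by (simp add: additive_def)
    show "Rep_witt g (- Rep_witt h f) = - Rep_witt h (Rep_witt g f) + - Rep_witt (witt_bracket g h) f" for f
      by (simp add: Rep_witt_simps additive.minus[OF additive_Rep_witt(1)])
    show "nmul ?p (- Rep_witt y x) = 0" for x :: "'k trunc_poly" and y
      by (simp add: trunc_vs.nmul_conv_scale)
  qed simp
  also have "(?Q ^^ (?p - 1)) (?Q g) = (?Q ^^ ?p) g"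
    by (simp add: n funpow_Suc_right del: funpow.simps)
  finally show "Rep_witt ((?Q ^^ ?p) g) a = Rep_witt (witt_bracket g (witt_pmap h)) a"
    unfolding funpow_uminus[OF additive_Rep_witt(1) odd]
    by (simp add: Rep_witt_simps additive.minus[OF additive_Rep_witt(1)] algebra_simps)
qed

text \<open>Up to a common sign, (h + t g)^p applied to a is a polynomial in t whose derivative is
  [g, x, ..., x] applied to a, at x = h + t g. Integrating from 0 to 1 produces
  \<open>jac\<close>.\<close>

lemma witt_pmap_add:
  fixes g h :: "'k::field_prime_char witt"
  assumes p: "CHAR('k) > 2"
  shows "witt_pmap (g + h) = witt_pmap g + witt_pmap h + witt.jac g h"
proof (rule witt_eqI)
  fix a
  let ?p = "CHAR('k)" and ?X = "\<lambda>h a. - Rep_witt h a"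
  define R where "R = lin_op (?X h) (?X g)"
  define r where "r = (R ^^ ?p) (const0 a)"
  define q where "q = (witt.ad_poly h g ^^ (?p - 1)) (const0 g)"
  have odd: "odd ?p" using p prime_odd_nat[OF CHAR_prime[where 'a = 'k]] by auto
  have addX: "additive (?X h)" for h :: "'k witt"
    using additive_Rep_witt(1)[of h] by (simp add: additive_def)
  obtain n where n: "?p = Suc n" using odd by (cases ?p) auto
  have "fderiv r = (R ^^ ?p) (fderiv (const0 a)) + conv (\<lambda>a w. - Rep_witt w a) (const0 a) q"
    unfolding r_def q_def
  proof (rule derivative_funpow_char[where D = fderiv and R = R and Q = "witt.ad_poly h g" and u = "const0 g"])
    show "additive R" unfolding R_def by (intro additive_lin_op addX)
    show "biadditive (conv (\<lambda>a (w :: 'k witt). - Rep_witt w a))"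
      by (intro biadditive_conv biadditive_Rep_witt)
    show "leibniz R R (witt.ad_poly h g) (conv (\<lambda>a w. - Rep_witt w a))"
      unfolding R_def witt.ad_poly_def
      by (intro leibniz_lin_op biadditive_Rep_witt addX leibniz_Rep_witt)
    show "fderiv (R f) = R (fderiv f) + conv (\<lambda>a w. - Rep_witt w a) f (const0 g)" for f
      unfolding R_def conv_const0[OF biadditive_Rep_witt] by (intro fderiv_lin_op addX)
    show "nmul ?p (conv (\<lambda>a (w :: 'k witt). - Rep_witt w a) x y) = 0" for x y
      by (simp add: nmul_fun fun_eq_iff trunc_vs.nmul_conv_scale)
  qed simp
  moreover have "additive (R ^^ ?p)"
    unfolding R_def by (intro additive_funpow additive_lin_op addX)
  ultimately have "fderiv r = (\<lambda>i. - Rep_witt (q i) a)"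
    by (simp add: additive.zero const0_conv[OF biadditive_Rep_witt])
  then have *: "trunc_scale (of_nat (Suc i)) (r (Suc i)) = - Rep_witt (q i) a" for i
    by (metis fderiv_def trunc_vs.nmul_conv_scale)
  \<comment> \<open>Integration determines the coefficients of degree 1 to p - 1, where i + 1 is
    invertible; those of degree 0 and p come from h^p and g^p and are found directly.\<close>
  have rS: "r (Suc i) = - trunc_scale (1 / of_nat (Suc i)) (Rep_witt (q i) a)" if "i < n" for i
  proof -
    have "of_nat (Suc i) \<noteq> (0 :: 'k)"
      unfolding of_nat_eq_0_iff_char_dvd using that n by (auto dest!: dvd_imp_le)
    then have "r (Suc i) = trunc_scale (1 / of_nat (Suc i)) (trunc_scale (of_nat (Suc i)) (r (Suc i)))"
      by (simp del: of_nat_Suc)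
    then show ?thesis by (simp add: * trunc_vs.scale_minus_right del: of_nat_Suc)
  qed
  have "(\<Sum>i\<le>?p. r i) = ((\<lambda>a. ?X h a + ?X g a) ^^ ?p) a"
    unfolding r_def R_def by (intro sum_lin_op_funpow addX) simp
  also have "(\<lambda>a. ?X h a + ?X g a) = ?X (g + h)"
    by (simp add: Rep_witt_simps fun_eq_iff)
  also have "((?X (g + h)) ^^ ?p) a = - Rep_witt (witt_pmap (g + h)) a"
    by (simp add: funpow_uminus[OF additive_Rep_witt(1) odd] witt_pmap.rep_eq)
  also have "(\<Sum>i\<le>?p. r i) = r 0 + (\<Sum>i<n. r (Suc i)) + r ?p"
    unfolding n sum.atMost_Suc_shift[of r n] by (simp add: lessThan_Suc_atMost[symmetric] add.assoc)
  also have "r 0 = - Rep_witt (witt_pmap h) a"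
    unfolding r_def R_def
    by (simp add: lin_op_funpow_0 const0_def funpow_uminus[OF additive_Rep_witt(1) odd] witt_pmap.rep_eq)
  also have "r ?p = - Rep_witt (witt_pmap g) a"
    unfolding r_def R_def
    by (simp add: lin_op_funpow_top(2)[OF addX addX] funpow_uminus[OF additive_Rep_witt(1) odd] witt_pmap.rep_eq)
  also have "(\<Sum>i<n. r (Suc i)) = - Rep_witt (witt.jac g h) a"
    using n by (simp add: witt.jac_def rS q_def[symmetric, simplified n] sum_negf additive.sum[OF additive_Rep_witt(2)] Rep_witt_simps q_def)
  finally show "Rep_witt (witt_pmap (g + h)) a = Rep_witt (witt_pmap g + witt_pmap h + witt.jac g h) a"
    by (simp add: Rep_witt_simps algebra_simps)
qed

lemma cochain1D:
  assumes "\<psi> \<in> cochain1"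
  shows "additive \<psi>" "\<psi> (witt_scale c g) = c * \<psi> g"
  using assms by (auto simp: cochain1_def linear_witt_iff additive_def)

lemma star_sum_cl_delta1:
  fixes \<psi> :: "'k::field_prime_char witt \<Rightarrow> 'k"
  assumes "\<psi> \<in> cochain1"
  shows "star_sum (cl_delta1 \<psi>) g h = \<psi> (witt.jac g h)"
proof -
  obtain n where n: "CHAR('k) = Suc n" "n \<noteq> 0"
    by (rule CHAR_SucE)
  then show ?thesis
    using n unfolding star_sum_def witt.jac_conv_words
    by (simp add: iter_bracket_conv_word cl_delta1_def additive.sum[OF cochain1D(1)[OF assms]] cochain1D(2)[OF assms])
qed

text \<open>Jacobson's formula \<open>witt_pmap_add\<close> seen through \<psi>.\<close>

lemma star_property_ind1:
  fixes \<psi> :: "'k::field_prime_char witt \<Rightarrow> 'k"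
  assumes "\<psi> \<in> cochain1" "CHAR('k) > 2"
  shows "star_property (cl_delta1 \<psi>) (ind1 \<psi>)"
proof -
  have "witt_pmap (witt_scale c g) = witt_scale (c ^ CHAR('k)) (witt_pmap g)" for c and g :: "'k witt"
  proof (rule witt_eqI)
    fix f
    have "(Rep_witt (witt_scale c g) ^^ n) f = trunc_scale (c ^ n) ((Rep_witt g ^^ n) f)" for n
      using Rep_witt[of g] by (induction n) (simp_all add: witt_scale.rep_eq is_derivation_iff)
    then show "Rep_witt (witt_pmap (witt_scale c g)) f = Rep_witt (witt_scale (c ^ CHAR('k)) (witt_pmap g)) f"
      by (simp add: Rep_witt_simps(5,7))
  qed
  then show ?thesis
    using assms by (simp add: star_property_def ind1_def star_sum_cl_delta1 witt_pmap_add cochain1D additive.add[OF cochain1D(1)])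
qed

text \<open>The \<open>p\<close>-th power of \<open>[\<cdot>, h]\<close> on the extension is a derivation lifting \<open>[\<cdot>, h\<^sup>p]\<close>, so it can
  differ from it only by a functional that kills brackets.\<close>
lemma ind2_bracket:
  fixes \<phi> :: "'k::field_prime_char witt \<Rightarrow> 'k witt \<Rightarrow> 'k"
  assumes \<phi>: "lie_cocycle \<phi>" and p: "CHAR('k) > 2"
  shows "ind2 (\<phi>, \<omega>) (witt_bracket g g') h = 0"
proof -
  interpret ext: lie_alg ext_scale "ext_bracket \<phi>"
    by (rule lie_alg_ext[OF \<phi>])
  have c: "\<phi> \<in> cl_cochain2" using \<phi> by (simp add: lie_cocycle_def)
  let ?p = "CHAR('k)" and ?Q = "\<lambda>v. witt_bracket v h" and ?R = "\<lambda>v. ext_bracket \<phi> v (h, 0)"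
  let ?H = "witt_pmap h"
  obtain n where n: "?p = Suc n" using p by (cases ?p) auto
  have "(?R ^^ Suc n) (x, b) = ((?Q ^^ Suc n) x, \<phi> ((?Q ^^ n) x) h)" for x b n
    by (induction n) (simp_all add: ext_bracket_def)
  then have R: "(?R ^^ ?p) (x, b) = (witt_bracket x ?H, \<phi> ((?Q ^^ n) x) h)" for x b
    using ad_witt_pmap[OF p, of h x] by (simp only: n)
  have "(?R ^^ ?p) (ext_bracket \<phi> (g, 0) (g', 0)) =
      ext_bracket \<phi> ((?R ^^ ?p) (g, 0)) (g', 0) + ext_bracket \<phi> (g, 0) ((?R ^^ ?p) (g', 0))"
    by (rule ext.br_funpow_char)
  then have "\<phi> ((?Q ^^ n) (witt_bracket g g')) h = \<phi> (witt_bracket g ?H) g' + \<phi> g (witt_bracket g' ?H)"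
    unfolding R by (simp add: ext_bracket_def[of \<phi> "(_, _)"] R)
  also have "\<dots> = \<phi> (witt_bracket g g') ?H"
  proof -
    have "\<phi> (witt_bracket g g') ?H - \<phi> (witt_bracket g ?H) g' + \<phi> (witt_bracket g' ?H) g = 0"
      using \<phi> by (auto simp: lie_cocycle_def cl_delta2_def fun_eq_iff)
    then show ?thesis
      using cl_cochain2D(5)[OF c, of g "witt_bracket g' ?H"] by (simp add: algebra_simps)
  qed
  finally show ?thesis
    by (simp add: ind2_def n iter_bracket_funpow)
qed

text \<open>Together with \<open>ind2_bracket\<close>, these facts allow \<open>witt_perfect\<close>
  to be applied to the first argument.\<close>

lemma additive_ind2:
  assumes "\<phi> \<in> cl_cochain2"
  shows "additive (\<lambda>g. ind2 (\<phi>, \<omega>) g h)" "ind2 (\<phi>, \<omega>) (witt_scale c g) h = c * ind2 (\<phi>, \<omega>) g h"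
proof -
  let ?Q = "\<lambda>v. witt_bracket v h"
  obtain n where n: "CHAR('a) = Suc n"
    by (rule CHAR_SucE)
  have "(?Q ^^ n) (witt_scale c g) = witt_scale c ((?Q ^^ n) g)"
    by (induction n) (simp_all add: witt.br_scale)
  then show "ind2 (\<phi>, \<omega>) (witt_scale c g) h = c * ind2 (\<phi>, \<omega>) g h"
    by (simp add: ind2_def n iter_bracket_funpow cl_cochain2D(2,3)[OF assms] right_diff_distrib)
  show "additive (\<lambda>g. ind2 (\<phi>, \<omega>) g h)"
    using additive.add[OF additive_funpow[OF witt.additive_br[of h], of n]]
    by (simp add: ind2_def n iter_bracket_funpow additive_def biadditive_simps[OF cl_cochain2D(1)[OF assms]])
qed

section \<open>A basis of the Witt algebra\<close>

lift_definition tmono :: "nat \<Rightarrow> 'k::field_prime_char trunc_poly" is "\<lambda>k. monom 1 k" .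

lift_definition tderiv :: "'k::field_prime_char trunc_poly \<Rightarrow> 'k trunc_poly" is pderiv
proof (unfold trunc_rel_def, elim dvdE)
  fix f g h :: "'k poly"
  assume "f - g = (monom 1 CHAR('k) - 1) * h"
  then have "pderiv f - pderiv g = pderiv ((monom 1 CHAR('k) - 1) * h)"
    by (simp flip: pderiv_diff)
  \<comment> \<open>The derivative of x^p - 1 is zero in characteristic p, so the ideal it generates
    is stable under d/dx.\<close>
  also have "\<dots> = (monom 1 CHAR('k) - 1) * pderiv h"
    by (simp add: pderiv_mult pderiv_diff pderiv_monom)
  finally show "(monom 1 CHAR('k) - 1) dvd (pderiv f - pderiv g)" by simp
qed

lemma tmono_0 [simp]: "tmono 0 = 1"
  by transfer (simp add: trunc_rel_def)

lemma tmono_mult: "tmono k * tmono l = tmono (k + l)"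
  by transfer (simp add: trunc_rel_def mult_monom)

lemma tmono_CHAR [simp]: "tmono CHAR('k) = (1 :: 'k::field_prime_char trunc_poly)"
  by transfer (simp add: trunc_rel_def)

lemma tmono_mod: "tmono (k mod CHAR('k)) = (tmono k :: 'k::field_prime_char trunc_poly)"
proof -
  have "tmono (CHAR('k) * m) = (1 :: 'k trunc_poly)" for m
    by (induction m) (simp_all flip: tmono_mult)
  then have "tmono (CHAR('k) * (k div CHAR('k)) + k mod CHAR('k)) = (tmono (k mod CHAR('k)) :: 'k trunc_poly)"
    by (simp only: tmono_mult[symmetric] mult_1_left)
  then show ?thesis by simp
qed

lemma tderiv_simps:
  "tderiv (f + g) = tderiv f + tderiv g"
  "tderiv (trunc_scale c f) = trunc_scale c (tderiv f)"
  "tderiv (f * g) = tderiv f * g + f * tderiv g"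
  by (transfer; simp add: trunc_rel_def pderiv_add pderiv_smult pderiv_mult)+

lemma mono_tderiv_mono: "tmono 1 * tderiv (tmono l) = trunc_scale (of_nat l) (tmono l)"
  by (cases l; transfer; simp add: trunc_rel_def pderiv_monom mult_monom smult_monom)

section \<open>Coordinates on \<open>A\<close> and on \<open>W\<close>\<close>

lift_definition tcoeff :: "'k::field_prime_char trunc_poly \<Rightarrow> nat \<Rightarrow> 'k" is
  "\<lambda>f. coeff (f mod (monom 1 CHAR('k) - 1))"
  by (simp add: trunc_rel_def flip: mod_eq_dvd_iff)

lemma degree_trunc: "degree (monom 1 CHAR('k) - 1 :: 'k::field_prime_char poly) = CHAR('k)"
proof -
  have "degree (monom 1 CHAR('k) + - 1 :: 'k poly) = degree (monom 1 CHAR('k) :: 'k poly)"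
    using prime_gt_0_nat[OF CHAR_prime[where 'a = 'k]] by (intro degree_add_eq_left) (simp add: degree_monom_eq)
  then show ?thesis by (simp add: degree_monom_eq)
qed

lemma tcoeff_simps:
  "tcoeff (f + g) i = tcoeff f i + tcoeff g i"
  "tcoeff (trunc_scale c f) i = c * tcoeff f i"
  by (transfer; simp add: poly_mod_add_left mod_smult_left)+

lemma tcoeff_mono:
  assumes "k < CHAR('k)"
  shows "tcoeff (tmono k :: 'k::field_prime_char trunc_poly) i = (if i = k then 1 else 0)"
proof -
  have "monom 1 k mod (monom 1 CHAR('k) - 1) = (monom 1 k :: 'k poly)"
    using assms by (intro mod_poly_less) (simp add: degree_trunc degree_monom_eq)
  then show ?thesis by transfer simp
qed

lemma tcoeff_expansion:
  "(f :: 'k::field_prime_char trunc_poly) = (\<Sum>i<CHAR('k). trunc_scale (tcoeff f i) (tmono i))"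
proof -
  have abs_add: "abs_trunc_poly (sum h A) = (\<Sum>i\<in>A. abs_trunc_poly (h i))" for h :: "nat \<Rightarrow> 'k poly" and A
    by (induction A rule: infinite_finite_induct) (simp_all add: zero_trunc_poly_def plus_trunc_poly.abs_eq[symmetric])
  obtain q :: "'k poly" where q: "f = abs_trunc_poly q"
    using trunc_poly.abs_induct[of "\<lambda>f. \<exists>q. f = abs_trunc_poly q"] by blast
  let ?m = "monom 1 CHAR('k) - 1 :: 'k poly" and ?r = "q mod (monom 1 CHAR('k) - 1)"
  have d: "coeff ?r i = 0" if "i \<ge> CHAR('k)" for i
  proof -
    have "?m \<noteq> 0" using degree_trunc[where 'k = 'k] prime_gt_0_nat[OF CHAR_prime[where 'a = 'k]] by auto
    then have "?r = 0 \<or> degree ?r < CHAR('k)"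
      using degree_mod_less[of ?m q] degree_trunc[where 'k = 'k] by simp
    then show ?thesis using that by (auto intro: coeff_eq_0)
  qed
  have "?r = (\<Sum>i<CHAR('k). monom (coeff ?r i) i)"
    by (rule poly_eqI) (use d in \<open>auto simp: coeff_sum if_distrib cong: if_cong\<close>)
  then have "abs_trunc_poly ?r = (\<Sum>i<CHAR('k). abs_trunc_poly (monom (coeff ?r i) i))"
    by (metis abs_add)
  also have "abs_trunc_poly ?r = f"
    unfolding q trunc_poly.abs_eq_iff trunc_rel_def by (metis mod_eq_dvd_iff mod_mod_trivial)
  also have "(\<Sum>i<CHAR('k). abs_trunc_poly (monom (coeff ?r i) i)) = (\<Sum>i<CHAR('k). trunc_scale (tcoeff f i) (tmono i))"
    by (simp add: q tcoeff.abs_eq tmono_def trunc_scale.abs_eq smult_monom)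
  finally show ?thesis .
qed

text \<open>The rule D(x^l) = l x^(l-1) D(x). The exponent l + p - 1 stands for l - 1 and stays
  meaningful at l = 0.\<close>

lemma Rep_witt_mono: "Rep_witt g (tmono l) = trunc_scale (of_nat l) (tmono (l + CHAR('k) - 1) * Rep_witt g (tmono 1))"
  for g :: "'k::field_prime_char witt"
proof -
  have D: "Rep_witt g (a * b) = Rep_witt g a * b + a * Rep_witt g b" for a b
    using Rep_witt[of g] by (simp add: is_derivation_iff)
  obtain n where n: "CHAR('k) = Suc n" by (rule CHAR_SucE)
  have S: "tmono (Suc n) = (1 :: 'k trunc_poly)" using tmono_CHAR[where 'k = 'k] n by simp
  have "Rep_witt g (tmono l) = trunc_scale (of_nat l) (tmono (l + n) * Rep_witt g (tmono 1))"
  proof (induction l)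
    case 0
    have "Rep_witt g (1 * 1) = Rep_witt g 1 + Rep_witt g 1"
      using D[of 1 1] by simp
    then show ?case by simp
  next
    case (Suc l)
    have "tmono (l + n) * tmono 1 = (tmono l * tmono (Suc n) :: 'k trunc_poly)"
      by (simp only: tmono_mult) simp
    then have *: "tmono (l + n) * tmono 1 = (tmono l :: 'k trunc_poly)" by (simp add: S)
    have "Rep_witt g (tmono (Suc l)) = Rep_witt g (tmono l * tmono 1)"
      by (simp add: tmono_mult)
    also have "\<dots> = trunc_scale (of_nat l) (tmono (l + n) * tmono 1 * Rep_witt g (tmono 1)) + tmono l * Rep_witt g (tmono 1)"
      by (simp add: D Suc trunc_scale_mult mult_ac)
    also have "\<dots> = trunc_scale (of_nat (Suc l)) (tmono l * Rep_witt g (tmono 1))"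
      by (simp only: * of_nat_Suc trunc_vs.scale_left_distrib trunc_vs.scale_one add.commute)
    also have "tmono l = (tmono l * tmono (Suc n) :: 'k trunc_poly)"
      by (simp add: S)
    also have "\<dots> = tmono (Suc l + n)"
      by (simp add: tmono_mult)
    finally show ?case .
  qed
  then show ?thesis by (simp add: n)
qed

text \<open>The algebra \<open>A\<close> is generated by x.\<close>

lemma witt_eqI_mono:
  assumes "Rep_witt g (tmono 1) = Rep_witt h (tmono 1)"
  shows "g = h"
proof (rule witt_eqI)
  fix f
  have "Rep_witt k f = (\<Sum>i<CHAR('a). trunc_scale (tcoeff f i) (Rep_witt k (tmono i)))" for k :: "'a witt"
    using Rep_witt[of k] by (subst tcoeff_expansion) (simp add: additive.sum[OF additive_Rep_witt(1)] is_derivation_iff)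
  moreover have "Rep_witt g (tmono i) = Rep_witt h (tmono i)" for i
    by (simp only: Rep_witt_mono[of g i] Rep_witt_mono[of h i] assms)
  ultimately show "Rep_witt g f = Rep_witt h f" by simp
qed

text \<open>\<open>e\<^bsub>-1\<^esub>\<close> is \<open>witt_e (p - 1)\<close>.\<close>
lift_definition witt_e :: "nat \<Rightarrow> 'k::field_prime_char witt" is "\<lambda>k f. tmono (Suc k) * tderiv f"
  by (simp add: is_derivation_iff tderiv_simps trunc_scale_mult algebra_simps)

lemma witt_e_mono: "Rep_witt (witt_e k) (tmono l) = trunc_scale (of_nat l) (tmono (k + l))"
proof -
  have "Rep_witt (witt_e k) (tmono l) = tmono k * (tmono 1 * tderiv (tmono l))"
    by (simp add: witt_e.rep_eq tmono_mult flip: mult.assoc)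
  then show ?thesis
    by (simp only: mono_tderiv_mono trunc_scale_mult tmono_mult)
qed

lemma witt_e_mod: "witt_e (k mod CHAR('k)) = (witt_e k :: 'k::field_prime_char witt)"
  by (rule witt_eqI_mono) (simp only: witt_e_mono flip: tmono_mult, simp add: tmono_mod)

lemma witt_e_cong: "k mod CHAR('k) = l mod CHAR('k) \<Longrightarrow> witt_e k = (witt_e l :: 'k::field_prime_char witt)"
  by (metis witt_e_mod)

lemma bracket_witt_e:
  "witt_bracket (witt_e i) (witt_e j) = witt_scale (of_nat j - of_nat i) (witt_e (i + j))"
proof (rule witt_eqI_mono)
  have s: "Rep_witt g (trunc_scale c f) = trunc_scale c (Rep_witt g f)" for g :: "'a witt" and c f
    using Rep_witt[of g] by (simp add: is_derivation_iff)
  show "Rep_witt (witt_bracket (witt_e i) (witt_e j)) (tmono 1) =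
      Rep_witt (witt_scale (of_nat j - of_nat i) (witt_e (i + j)) :: 'a witt) (tmono 1)"
    by (simp add: Rep_witt_simps witt_e_mono s add_ac flip: trunc_vs.scale_left_diff_distrib del: One_nat_def of_nat_Suc)
qed

text \<open>If D(x) is the sum of the c_i x^(i+1), then multiplying by x^(p-1), the inverse of x,
  moves c_i to degree i.\<close>

definition wcoeff :: "'k::field_prime_char witt \<Rightarrow> nat \<Rightarrow> 'k" where
  "wcoeff g i = tcoeff (tmono (CHAR('k) - 1) * Rep_witt g (tmono 1)) i"

lemma wcoeff_simps:
  "wcoeff (g + h) i = wcoeff g i + wcoeff h i"
  "wcoeff (witt_scale c g) i = c * wcoeff g i"
  by (simp_all add: wcoeff_def Rep_witt_simps trunc_scale_mult tcoeff_simps distrib_left)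

lemma wcoeff_witt_e:
  "wcoeff (witt_e k :: 'k::field_prime_char witt) i = (if i = k mod CHAR('k) then 1 else 0)"
proof -
  obtain n where n: "CHAR('k) = Suc n" by (rule CHAR_SucE)
  have "tmono n * tmono (Suc k) = (tmono k * tmono CHAR('k) :: 'k trunc_poly)"
    by (simp add: tmono_mult n add.commute del: tmono_CHAR)
  then have "tmono n * tmono (Suc k) = (tmono (k mod CHAR('k)) :: 'k trunc_poly)"
    by (simp add: tmono_mod)
  then show ?thesis
    unfolding wcoeff_def witt_e_mono by (simp add: n tcoeff_mono)
qed

lemma wcoeff_expansion:
  "(g :: 'k::field_prime_char witt) = (\<Sum>i<CHAR('k). witt_scale (wcoeff g i) (witt_e i))"
proof (rule witt_eqI_mono)
  obtain n where n: "CHAR('k) = Suc n" by (rule CHAR_SucE)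
  have S: "tmono 1 * tmono (CHAR('k) - 1) = (1 :: 'k trunc_poly)"
    using tmono_CHAR[where 'k = 'k] n by (simp add: tmono_mult)
  have "Rep_witt (\<Sum>i<CHAR('k). witt_scale (wcoeff g i) (witt_e i)) (tmono 1) =
      (\<Sum>i<CHAR('k). trunc_scale (wcoeff g i) (tmono 1 * tmono i))"
    by (simp add: additive.sum[OF additive_Rep_witt(2)] Rep_witt_simps witt_e_mono tmono_mult del: One_nat_def)
      (simp add: add.commute)
  also have "\<dots> = tmono 1 * (\<Sum>i<CHAR('k). trunc_scale (wcoeff g i) (tmono i))"
    by (simp add: sum_distrib_left trunc_scale_mult)
  also have "\<dots> = tmono 1 * (tmono (CHAR('k) - 1) * Rep_witt g (tmono 1))"
    unfolding wcoeff_def by (simp flip: tcoeff_expansion)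
  also have "\<dots> = Rep_witt g (tmono 1)"
    by (simp only: mult.assoc[symmetric] S mult_1_left)
  finally show "Rep_witt g (tmono 1) = Rep_witt (\<Sum>i<CHAR('k). witt_scale (wcoeff g i) (witt_e i)) (tmono 1)" ..
qed

lemma witt_linear_eq_0:
  fixes F :: "'k::field_prime_char witt \<Rightarrow> 'k"
  assumes "additive F" "\<And>c g. F (witt_scale c g) = c * F g" "\<And>i. i < CHAR('k) \<Longrightarrow> F (witt_e i) = 0"
  shows "F g = 0"
  by (subst wcoeff_expansion) (simp add: additive.sum[OF assms(1)] assms)

text \<open>Perfectness of \<open>W\<close>: [e_0, e_i] = i e_i reaches every i other than 0, and
  [e_-1, e_1] = 2 e_0 reaches e_0.\<close>

lemma witt_perfect:
  fixes F :: "'k::field_prime_char witt \<Rightarrow> 'k"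
  assumes F: "additive F" "\<And>c g. F (witt_scale c g) = c * F g" and p: "CHAR('k) > 2"
    and 0: "\<And>g h. F (witt_bracket g h) = 0"
  shows "F g = 0"
proof (rule witt_linear_eq_0[OF F])
  fix i assume i: "i < CHAR('k)"
  show "F (witt_e i) = 0"
  proof (cases "i = 0")
    case True
    obtain n where n: "CHAR('k) = Suc n" by (rule CHAR_SucE)
    have "of_nat (Suc n) = (0 :: 'k)" by (metis n of_nat_CHAR)
    then have "of_nat n = (-1 :: 'k)" by (simp add: eq_neg_iff_add_eq_0 add.commute)
    moreover have "witt_e (n + 1) = (witt_e 0 :: 'k witt)" using n by (intro witt_e_cong) simp
    ultimately have "2 * F (witt_e 0) = F (witt_bracket (witt_e n) (witt_e 1))"
      by (simp add: bracket_witt_e F)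
    moreover have "(2 :: 'k) \<noteq> 0"
      using p of_nat_eq_0_iff_char_dvd[of 2, where 'a = 'k] by (auto dest: dvd_imp_le)
    ultimately show ?thesis using True 0 by simp
  next
    case False
    have "of_nat i * F (witt_e i) = F (witt_bracket (witt_e 0) (witt_e i))"
      by (simp add: bracket_witt_e F)
    moreover have "of_nat i \<noteq> (0 :: 'k)"
      using i False by (auto simp: of_nat_eq_0_iff_char_dvd dest: dvd_imp_le)
    ultimately show ?thesis using 0 by simp
  qed
qed

section \<open>Ordinary two-cocycles\<close>

lemma of_nat_mod_CHAR [simp]: "of_nat (k mod CHAR('k)) = (of_nat k :: 'k::field_prime_char)"
proof -
  have "(of_nat k :: 'k) = of_nat (CHAR('k) * (k div CHAR('k)) + k mod CHAR('k))"
    by simp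
  then show ?thesis
    by (simp only: of_nat_add of_nat_mult of_nat_CHAR mult_zero_left add_0_left)
qed

lemma of_nat_nonzero: "0 < k \<Longrightarrow> k < CHAR('k) \<Longrightarrow> of_nat k \<noteq> (0 :: 'k::field_prime_char)"
  by (auto simp: of_nat_eq_0_iff_char_dvd dest: dvd_imp_le)

lemma mod_neg_iff:
  fixes i j p :: nat
  assumes "p > 0"
  shows "(p - i mod p) mod p = j mod p \<longleftrightarrow> p dvd i + j"
proof -
  define a b where "a = i mod p" and "b = j mod p"
  have ab: "a < p" "b < p" using assms by (simp_all add: a_def b_def)
  have "p dvd i + j \<longleftrightarrow> (a + b) mod p = 0"
    by (simp add: dvd_eq_mod_eq_0 a_def b_def mod_add_eq)
  also have "\<dots> \<longleftrightarrow> (p - a) mod p = b"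
    using ab by (cases "a = 0"; cases "a + b < p") (auto simp: mod_if)
  finally show ?thesis by (simp add: a_def b_def)
qed

text \<open>The Virasoro cocycle in coordinates; the index (p - i) mod p is -i, with 0 sent to
  itself.\<close>

definition vir_cocycle :: "'k::field_prime_char witt \<Rightarrow> 'k witt \<Rightarrow> 'k" where
  "vir_cocycle g h = (\<Sum>i<CHAR('k). (of_nat i ^ 3 - of_nat i) * (wcoeff g i * wcoeff h ((CHAR('k) - i) mod CHAR('k))))"

lemma vir_cocycle_witt_e:
  "vir_cocycle (witt_e i) (witt_e j :: 'k::field_prime_char witt) =
     (if CHAR('k) dvd i + j then of_nat i ^ 3 - of_nat i else 0)"
proof -
  have p: "CHAR('k) > 0" by (rule CHAR_SucE[where 'k = 'k]) simp
  have "vir_cocycle (witt_e i) (witt_e j :: 'k witt) = (\<Sum>l<CHAR('k). if l = i mod CHAR('k) then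
      (of_nat l ^ 3 - of_nat l) * (if (CHAR('k) - l) mod CHAR('k) = j mod CHAR('k) then 1 else 0) else 0)"
    unfolding vir_cocycle_def wcoeff_witt_e by (intro sum.cong) auto
  also have "\<dots> = (of_nat i ^ 3 - of_nat i) * (if CHAR('k) dvd i + j then 1 else 0)"
    using p by (subst sum.delta) (simp_all add: mod_neg_iff[OF p])
  finally show ?thesis by simp
qed

lemma biadditive_vir_cocycle: "biadditive vir_cocycle"
  by (simp add: biadditive_def vir_cocycle_def wcoeff_simps sum.distrib distrib_left distrib_right)

lemma vir_cocycle_scale:
  "vir_cocycle (witt_scale c g) h = c * vir_cocycle g h"
  "vir_cocycle g (witt_scale c h) = c * vir_cocycle g h"
  by (simp_all add: vir_cocycle_def wcoeff_simps sum_distrib_left mult_ac)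

text \<open>The cubic is odd, so replacing i by -i changes the sign of the sum, and 2 is
  invertible.\<close>

lemma vir_cocycle_self:
  fixes g :: "'k::field_prime_char witt"
  assumes "CHAR('k) > 2"
  shows "vir_cocycle g g = 0"
proof -
  let ?p = "CHAR('k)" and ?n = "\<lambda>i. (CHAR('k) - i) mod CHAR('k)"
  define t where "t i = (of_nat i ^ 3 - of_nat i) * (wcoeff g i * wcoeff g (?n i))" for i
  have n: "?n (?n i) = i" "?n i < ?p" if "i < ?p" for i
    using that assms by (cases "i = 0", simp_all)
  have on: "of_nat (?n i) = (- of_nat i :: 'k)" if "i < ?p" for i
    using that by (simp add: of_nat_diff)
  have "(\<Sum>i<?p. t i) = (\<Sum>i<?p. - t i)"
  proof (rule sum.reindex_bij_witness[of _ ?n ?n])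
    fix i assume i: "i \<in> {..<?p}"
    then show "- t (?n i) = t i"
      using n[of i] on[of i] unfolding t_def by (simp only: lessThan_iff) (simp add: power3_eq_cube mult.commute algebra_simps)
  qed (use n in auto)
  then have "2 * vir_cocycle g g = 0"
    by (simp add: vir_cocycle_def t_def sum_negf eq_neg_iff_add_eq_0 flip: mult_2)
  moreover have "(2 :: 'k) \<noteq> 0"
    using of_nat_nonzero[of 2, where 'k = 'k] assms by simp
  ultimately show ?thesis by simp
qed

lemma vir_cocycle_cochain: "CHAR('k) > 2 \<Longrightarrow> (vir_cocycle :: 'k::field_prime_char witt \<Rightarrow> _) \<in> cl_cochain2"
  by (simp add: cl_cochain2_def linear_witt_iff vir_cocycle_scale vir_cocycle_self
      biadditive_simps[OF biadditive_vir_cocycle])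

lemma cl_delta2_additive:
  assumes "\<phi> \<in> cl_cochain2"
  shows "additive (\<lambda>x. cl_delta2 \<phi> x y z)" "additive (\<lambda>y. cl_delta2 \<phi> x y z)" "additive (\<lambda>z. cl_delta2 \<phi> x y z)"
    "cl_delta2 \<phi> (witt_scale c x) y z = c * cl_delta2 \<phi> x y z"
    "cl_delta2 \<phi> x (witt_scale c y) z = c * cl_delta2 \<phi> x y z"
    "cl_delta2 \<phi> x y (witt_scale c z) = c * cl_delta2 \<phi> x y z"
  using cl_cochain2D(2,3)[OF assms]
  by (simp_all add: additive_def cl_delta2_def biadditive_simps[OF cl_cochain2D(1)[OF assms]]
      witt.br_simps witt.br_scale witt.br_scale_right algebra_simps)

lemma lie_cocycleI:
  fixes \<phi> :: "'k::field_prime_char witt \<Rightarrow> 'k witt \<Rightarrow> 'k"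
  assumes \<phi>: "\<phi> \<in> cl_cochain2"
    and e: "\<And>i j k. i < CHAR('k) \<Longrightarrow> j < CHAR('k) \<Longrightarrow> k < CHAR('k) \<Longrightarrow> cl_delta2 \<phi> (witt_e i) (witt_e j) (witt_e k) = 0"
  shows "lie_cocycle \<phi>"
proof -
  note d = cl_delta2_additive[OF \<phi>]
  have 1: "cl_delta2 \<phi> (witt_e i) (witt_e j) z = 0" if "i < CHAR('k)" "j < CHAR('k)" for i j z
    by (rule witt_linear_eq_0[OF d(3)]) (simp_all add: d e that)
  have 2: "cl_delta2 \<phi> (witt_e i) y z = 0" if "i < CHAR('k)" for i y z
    by (rule witt_linear_eq_0[OF d(2)]) (simp_all add: d 1 that)
  have "cl_delta2 \<phi> x y z = 0" for x y z
    by (rule witt_linear_eq_0[OF d(1)]) (simp_all add: d 2)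
  then show ?thesis
    using \<phi> by (simp add: lie_cocycle_def fun_eq_iff)
qed

text \<open>Everything vanishes unless i + j + k = 0 modulo p; there, substituting k = -i - j leaves
  a polynomial identity.\<close>

lemma lie_cocycle_vir:
  assumes "CHAR('k) > 2"
  shows "lie_cocycle (vir_cocycle :: 'k::field_prime_char witt \<Rightarrow> _)"
proof (rule lie_cocycleI[OF vir_cocycle_cochain[OF assms]])
  fix i j k
  let ?f = "\<lambda>i. of_nat i ^ 3 - of_nat i :: 'k" and ?c = "CHAR('k) dvd i + j + k"
  have d: "cl_delta2 vir_cocycle (witt_e i) (witt_e j) (witt_e k :: 'k witt) =
    (if ?c then (of_nat j - of_nat i) * ?f (i + j) - (of_nat k - of_nat i) * ?f (i + k) + (of_nat k - of_nat j) * ?f (j + k) else 0)"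
    unfolding cl_delta2_def bracket_witt_e vir_cocycle_scale vir_cocycle_witt_e by (simp add: add_ac)
  show "cl_delta2 vir_cocycle (witt_e i) (witt_e j) (witt_e k :: 'k witt) = 0"
  proof (cases ?c)
    case True
    then have "of_nat (i + j + k) = (0 :: 'k)" by (simp only: of_nat_eq_0_iff_char_dvd)
    then have k: "of_nat k = (- of_nat i - of_nat j :: 'k)" by (simp add: eq_neg_iff_add_eq_0 algebra_simps)
    show ?thesis
      unfolding d of_nat_add k by (simp add: power3_eq_cube algebra_simps)
  qed (simp add: d)
qed

lemma lie_cocycle_delta1:
  assumes "\<psi> \<in> cochain1"
  shows "lie_cocycle (cl_delta1 \<psi>)"
proof -
  note \<psi> = cochain1D(2)[OF assms] additive.add[OF cochain1D(1)[OF assms]]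
    additive.zero[OF cochain1D(1)[OF assms]] additive.minus[OF cochain1D(1)[OF assms]]
    additive.diff[OF cochain1D(1)[OF assms]]
  have "cl_delta2 (cl_delta1 \<psi>) x y z = 0" for x y z
  proof -
    have "cl_delta2 (cl_delta1 \<psi>) x y z = \<psi> (witt_bracket (witt_bracket x y) z + witt_bracket (witt_bracket y z) x + witt_bracket (witt_bracket z x) y)"
      by (simp add: cl_delta2_def cl_delta1_def \<psi> witt.br_antisym[of z x] witt.br_simps)
    then show ?thesis by (simp add: witt.jacobi \<psi>)
  qed
  moreover have "cl_delta1 \<psi> \<in> cl_cochain2"
    by (simp add: cl_cochain2_def linear_witt_iff cl_delta1_def witt.br_simps witt.br_scale
        witt.br_scale_right witt.br_self \<psi>)
  ultimately show ?thesis by (simp add: lie_cocycle_def fun_eq_iff)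
qed

lemma lie_cocycle_diff:
  assumes "lie_cocycle \<phi>" "lie_cocycle \<phi>'"
  shows "lie_cocycle (\<lambda>g h. \<phi> g h - \<phi>' g h)"
proof -
  have "cl_delta2 (\<lambda>g h. \<phi> g h - \<phi>' g h) x y z = cl_delta2 \<phi> x y z - cl_delta2 \<phi>' x y z" for x y z
    by (simp add: cl_delta2_def)
  moreover have "(\<lambda>g h. \<phi> g h - \<phi>' g h) \<in> cl_cochain2"
    using assms by (simp add: lie_cocycle_def cl_cochain2_def linear_witt_iff right_diff_distrib)
  ultimately show ?thesis
    using assms by (simp add: lie_cocycle_def fun_eq_iff)
qed

lemma cl_cochain2_eqI:
  fixes \<phi> :: "'k::field_prime_char witt \<Rightarrow> 'k witt \<Rightarrow> 'k"
  assumes "\<phi> \<in> cl_cochain2" "\<phi>' \<in> cl_cochain2"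
    and e: "\<And>i j. i < CHAR('k) \<Longrightarrow> j < CHAR('k) \<Longrightarrow> \<phi> (witt_e i) (witt_e j) = \<phi>' (witt_e i) (witt_e j)"
  shows "\<phi> g h = \<phi>' g h"
proof -
  note \<phi> = cl_cochain2D(2,3)[OF assms(1)] cl_cochain2D(2,3)[OF assms(2)]
    biadditive_simps[OF cl_cochain2D(1)[OF assms(1)]] biadditive_simps[OF cl_cochain2D(1)[OF assms(2)]]
  have 1: "\<phi> (witt_e i) h - \<phi>' (witt_e i) h = 0" if "i < CHAR('k)" for i h
    by (rule witt_linear_eq_0[where F = "\<lambda>h. \<phi> (witt_e i) h - \<phi>' (witt_e i) h"])
      (simp_all add: additive_def \<phi> that e right_diff_distrib)
  have "\<phi> g h - \<phi>' g h = 0"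
  proof (rule witt_linear_eq_0[where F = "\<lambda>g. \<phi> g h - \<phi>' g h"])
    show "\<phi> (witt_e i) h - \<phi>' (witt_e i) h = 0" if "i < CHAR('k)" for i
      using that by (rule 1)
  qed (simp_all add: additive_def \<phi> right_diff_distrib)
  then show ?thesis by simp
qed

text \<open>Weights other than zero are killed by \<open>e\<^sub>0\<close>; in weight zero the cocycle identity for
  \<open>e\<^sub>1, e\<^sub>j, e\<^bsub>-1-j\<^esub>\<close> is a recursion whose only solutions are the multiples of \<open>j\<^sup>3 - j\<close>.\<close>
lemma normalized_cocycle:
  fixes \<phi> :: "'k::field_prime_char witt \<Rightarrow> 'k witt \<Rightarrow> 'k"
  assumes \<phi>: "lie_cocycle \<phi>" and p: "CHAR('k) > 3"
    and n0: "\<And>i. i < CHAR('k) \<Longrightarrow> \<phi> (witt_e 0) (witt_e i) = 0"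
    and n1: "\<phi> (witt_e 1) (witt_e (CHAR('k) - 1)) = 0"
  shows "\<exists>a. \<forall>g h. \<phi> g h = a * vir_cocycle g h"
proof -
  let ?p = "CHAR('k)"
  have c: "\<phi> \<in> cl_cochain2" using \<phi> by (simp add: lie_cocycle_def)
  note anti = cl_cochain2D(5)[OF c]
  have n0': "\<phi> (witt_e 0) (witt_e i) = 0" for i
    using n0[of "i mod ?p"] p by (simp add: witt_e_mod)
  have coc: "(of_nat j - of_nat i) * \<phi> (witt_e (i + j)) (witt_e k) - (of_nat k - of_nat i) * \<phi> (witt_e (i + k)) (witt_e j)
      + (of_nat k - of_nat j) * \<phi> (witt_e (j + k)) (witt_e i) = 0" for i j k
  proof -
    have "cl_delta2 \<phi> (witt_e i) (witt_e j) (witt_e k) = 0"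
      using \<phi> by (simp add: lie_cocycle_def fun_eq_iff)
    then show ?thesis by (simp only: cl_delta2_def bracket_witt_e cl_cochain2D(2)[OF c])
  qed
  have off: "\<phi> (witt_e i) (witt_e j) = 0" if "\<not> ?p dvd i + j" for i j
  proof -
    have "of_nat (i + j) * \<phi> (witt_e i) (witt_e j) = 0"
    proof -
      have "\<phi> (witt_e (i + j)) (witt_e 0) = 0"
        using anti[of "witt_e (i + j)" "witt_e 0"] n0'[of "i + j"] by (simp only: neg_equal_0_iff_equal)
      then have "- of_nat i * \<phi> (witt_e i) (witt_e j) + of_nat j * \<phi> (witt_e j) (witt_e i) = 0"
        using coc[of 0 i j] by simp
      then show ?thesis
        by (subst (asm) anti[of "witt_e j"]) (simp only: of_nat_add distrib_right, simp add: algebra_simps neg_eq_iff_add_eq_0)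
    qed
    moreover have "of_nat (i + j) \<noteq> (0 :: 'k)"
      using that by (simp only: of_nat_eq_0_iff_char_dvd not_False_eq_True)
    ultimately show ?thesis by simp
  qed
  define f where "f i = \<phi> (witt_e i) (witt_e (?p - i))" for i
  \<comment> \<open>The identity for e_j, e_1, e_k with j + 1 + k = p; its middle term pairs e_-1
    with e_1 and vanishes by \<open>n1\<close>.\<close>
  have rec: "(of_nat j - 1) * f (Suc j) = (of_nat j + 2) * f j" if j: "Suc j < ?p" for j
  proof -
    obtain k where k: "?p = Suc j + k" using le_Suc_ex[OF less_imp_le[OF j]] by blast
    have "of_nat (Suc j + k) = (0 :: 'k)" by (metis k of_nat_CHAR)
    then have ok: "of_nat k = (- of_nat j - 1 :: 'k)" by (simp add: eq_neg_iff_add_eq_0 algebra_simps)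
    have "\<phi> (witt_e (j + k)) (witt_e 1) = 0"
      using n1 anti[of "witt_e (j + k)" "witt_e 1"] k by simp
    then have "(of_nat j - 1) * f (Suc j) = (of_nat k - 1) * \<phi> (witt_e (Suc k)) (witt_e j)"
      using coc[of j 1 k] k by (simp add: f_def)
    also have "\<phi> (witt_e (Suc k)) (witt_e j) = - f j"
      using anti[of "witt_e (Suc k)" "witt_e j"] k by (simp add: f_def)
    finally show ?thesis by (simp add: ok algebra_simps)
  qed
  have six: "(6 :: 'k) \<noteq> 0"
    using of_nat_nonzero[of 2, where 'k = 'k] of_nat_nonzero[of 3, where 'k = 'k] p
      mult_eq_0_iff[of "2 :: 'k" 3] by simp
  \<comment> \<open>At j = 1 the recursion does not restrict \<open>f 2\<close>, which is the one
    free parameter. The cubic j^3 - j equals 6 at j = 2, and 6 is invertible since p > 3.\<close>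
  define a where "a = f 2 / 6"
  have f: "f j = a * (of_nat j ^ 3 - of_nat j)" if "2 \<le> j" "j < ?p" for j
    using that
  proof (induction j rule: dec_induct)
    case base
    then show ?case using six by (simp add: a_def)
  next
    case (step j)
    have "of_nat (j - 1) \<noteq> (0 :: 'k)" using step by (intro of_nat_nonzero) auto
    then have "of_nat j - 1 \<noteq> (0 :: 'k)" using step by (simp add: of_nat_diff)
    moreover have "(of_nat j - 1) * f (Suc j) = (of_nat j + 2) * (a * (of_nat j ^ 3 - of_nat j))"
      using rec[of j] step by simp
    then have "(of_nat j - 1) * f (Suc j) = (of_nat j - 1) * (a * (of_nat (Suc j) ^ 3 - of_nat (Suc j)))"
      by (simp add: power3_eq_cube algebra_simps)
    ultimately show ?case by simp
  qed
  have f': "f j = a * (of_nat j ^ 3 - of_nat j)" if "j < ?p" for j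
  proof -
    consider "j = 0" | "j = 1" | "j \<ge> 2" by linarith
    then show ?thesis
      by cases (use f that n0' n1 in \<open>auto simp: f_def\<close>)
  qed
  have "\<phi> g h = a * vir_cocycle g h" for g h
  proof (rule cl_cochain2_eqI[OF c])
    show "(\<lambda>g h. a * vir_cocycle g h) \<in> cl_cochain2"
      using vir_cocycle_cochain[where 'k = 'k] p
      by (simp add: cl_cochain2_def linear_witt_iff distrib_left mult.left_commute)
    fix i j assume ij: "i < ?p" "j < ?p"
    show "\<phi> (witt_e i) (witt_e j) = a * vir_cocycle (witt_e i) (witt_e j)"
    proof (cases "?p dvd i + j")
      case True
      then have "witt_e j = (witt_e (?p - i) :: 'k witt)"
        using ij mod_neg_iff[of ?p i j] by (intro witt_e_cong) simp
      then show ?thesis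
        using f'[OF ij(1)] ij True by (simp add: f_def vir_cocycle_witt_e)
    qed (simp add: off vir_cocycle_witt_e)
  qed
  then show ?thesis by blast
qed

lemma lie_cocycle_classification:
  fixes \<phi> :: "'k::field_prime_char witt \<Rightarrow> 'k witt \<Rightarrow> 'k"
  assumes \<phi>: "lie_cocycle \<phi>" and p: "CHAR('k) > 3"
  obtains a \<psi> where "\<psi> \<in> cochain1" "\<And>g h. \<phi> g h = a * vir_cocycle g h + cl_delta1 \<psi> g h"
proof -
  let ?p = "CHAR('k)"
  have c: "\<phi> \<in> cl_cochain2" using \<phi> by (simp add: lie_cocycle_def)
  \<comment> \<open>The values of \<psi> on the basis, forced by the normalization: its coboundary
    takes (e_0, e_i) to i \<psi>(e_i) and (e_1, e_-1) to -2 \<psi>(e_0).\<close>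
  define y where "y i = (if i = 0 then - \<phi> (witt_e 1) (witt_e (?p - 1)) / 2 else \<phi> (witt_e 0) (witt_e i) / of_nat i)" for i
  define \<psi> where "\<psi> g = (\<Sum>i<?p. wcoeff g i * y i)" for g
  have \<psi>: "\<psi> \<in> cochain1"
    by (simp add: cochain1_def linear_witt_iff \<psi>_def wcoeff_simps distrib_right sum.distrib sum_distrib_left mult.assoc)
  have \<psi>e: "\<psi> (witt_e i) = y (i mod ?p)" for i
    using p by (simp add: \<psi>_def wcoeff_witt_e if_distrib[of "\<lambda>x. x * _"] cong: if_cong)
  have "\<exists>a. \<forall>g h. \<phi> g h - cl_delta1 \<psi> g h = a * vir_cocycle g h"
  proof (rule normalized_cocycle[OF lie_cocycle_diff[OF \<phi> lie_cocycle_delta1[OF \<psi>]] p])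
    show "\<phi> (witt_e 0) (witt_e i) - cl_delta1 \<psi> (witt_e 0) (witt_e i) = 0" if "i < ?p" for i
    proof (cases "i = 0")
      case True
      then show ?thesis by (simp add: cl_delta1_def cl_cochain2D(4)[OF c] bracket_witt_e cochain1D(2)[OF \<psi>] additive.zero[OF cochain1D(1)[OF \<psi>]])
    next
      case False
      then show ?thesis
        using that of_nat_nonzero[of i, where 'k = 'k]
        by (simp add: cl_delta1_def bracket_witt_e cochain1D(2)[OF \<psi>] \<psi>e y_def)
    qed
    obtain n where n: "?p = Suc n" by (rule CHAR_SucE)
    have "of_nat (Suc n) = (0 :: 'k)" by (metis n of_nat_CHAR)
    then have on: "of_nat n = (-1 :: 'k)" by (simp add: eq_neg_iff_add_eq_0 add.commute)
    have "(2 :: 'k) \<noteq> 0"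
      using of_nat_nonzero[of 2, where 'k = 'k] p by simp
    then show "\<phi> (witt_e 1) (witt_e (?p - 1)) - cl_delta1 \<psi> (witt_e 1) (witt_e (?p - 1)) = 0"
      by (simp add: cl_delta1_def bracket_witt_e cochain1D(2)[OF \<psi>] additive.minus[OF cochain1D(1)[OF \<psi>]] \<psi>e y_def n on)
  qed
  then show ?thesis using that \<psi> by (metis diff_add_cancel)
qed

section \<open>Restricted two-cocycles\<close>

text \<open>\<open>star_sum \<phi>\<close> is a symmetric additive cocycle that vanishes on each
  line spanned by a basis vector. Demanding \<omega> = 0 on these lines forces its value everywhere,
  by adding the components one at a time.\<close>

lemma star_property_exists:
  fixes \<phi> :: "'k::field_prime_char witt \<Rightarrow> 'k witt \<Rightarrow> 'k"
  assumes \<phi>: "lie_cocycle \<phi>" and p: "CHAR('k) > 2"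
  obtains \<omega> where "star_property \<phi> \<omega>"
proof -
  let ?p = "CHAR('k)" and ?c = "star_sum \<phi>"
  note coc = star_sum_cocycle[OF \<phi> p] and comm = star_sum_commute[OF \<phi> p]
  define u where "u k g = witt_scale (wcoeff g k) (witt_e k)" for k and g :: "'k witt"
  define S where "S k g = (\<Sum>i<k. u i g)" for k g
  \<comment> \<open>The correction accumulated while adding the first k components.\<close>
  define W where "W k g = (\<Sum>i<k. ?c (S i g) (u i g))" for k g
  have u: "u k (g + h) = u k g + u k h" "u k (witt_scale a g) = witt_scale a (u k g)" for k g h a
    by (simp_all add: u_def wcoeff_simps witt_vs.scale_left_distrib)
  have S: "S k (g + h) = S k g + S k h" "S k (witt_scale a g) = witt_scale a (S k g)" for k g h a
    by (simp_all add: S_def u sum.distrib witt_vs.scale_sum_right)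
  have uu: "?c (u k g) (u k h) = 0" for k g h
  proof (rule star_sum_commuting[OF \<phi>])
    have "\<phi> \<in> cl_cochain2" using \<phi> by (simp add: lie_cocycle_def)
    then show "\<phi> (u k g) (u k h) = 0"
      by (simp add: u_def cl_cochain2D(2-4))
    show "witt_bracket (u k g) (u k h) = 0"
      by (simp add: u_def witt.br_scale witt.br_scale_right witt.br_self)
  qed
  have "W k (g + h) = W k g + W k h + ?c (S k g) (S k h)" for k g h
  proof (induction k)
    case 0
    have "?c 0 0 = 0" by (rule star_sum_commuting[OF \<phi>])
        (use \<phi> in \<open>simp_all add: witt.br_self cl_cochain2D(4) lie_cocycle_def\<close>)
    then show ?case by (simp add: W_def S_def)
  next
    case (Suc k)
    let ?x = "S k g" and ?y = "S k h" and ?a = "u k g" and ?b = "u k h"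
    \<comment> \<open>Three instances of the cocycle identity regroup (x + y) + (a + b) as (x + a) +
      (y + b).\<close>
    have 1: "?c ?x ?a + ?c (?x + ?a) (?y + ?b) = ?c ?a (?y + ?b) + ?c ?x (?a + (?y + ?b))"
      by (rule coc)
    have 2: "?c ?a ?b + ?c (?a + ?b) ?y = ?c ?b ?y + ?c ?a (?b + ?y)"
      by (rule coc)
    have 3: "?c ?x ?y + ?c (?x + ?y) (?a + ?b) = ?c ?y (?a + ?b) + ?c ?x (?y + (?a + ?b))"
      by (rule coc)
    have "?c (?x + ?y) (?a + ?b) + ?c ?x ?y = ?c ?x ?a + ?c ?y ?b + ?c (?x + ?a) (?y + ?b)"
      using 1 2 3 uu[of k g h] comm[of "?a + ?b" ?y] comm[of ?b ?y]
      by (simp add: algebra_simps)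
    moreover have "S (Suc k) g = S k g + u k g" "W (Suc k) g = W k g + ?c (S k g) (u k g)" for g
      by (simp_all add: W_def S_def)
    ultimately show ?case
      by (simp add: Suc u S add_ac)
  qed
  moreover have "S ?p g = g" for g
    unfolding S_def u_def by (rule wcoeff_expansion[symmetric])
  moreover have "W ?p (witt_scale a g) = a ^ ?p * W ?p g" for a g
    by (simp add: W_def u S star_sum_homogeneous[OF \<phi>] sum_distrib_left)
  ultimately have "star_property \<phi> (W ?p)"
    by (simp add: star_property_def)
  then show ?thesis by (rule that)
qed

text \<open>\<open>ind2\<close> is linear in its first argument and kills brackets there, so
  perfectness makes it zero on every Lie cocycle.\<close>

lemma cocycles2_iff:
  fixes \<phi> :: "'k::field_prime_char witt \<Rightarrow> 'k witt \<Rightarrow> 'k"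
  assumes "CHAR('k) > 2"
  shows "(\<phi>, \<omega>) \<in> cocycles2 \<longleftrightarrow> lie_cocycle \<phi> \<and> star_property \<phi> \<omega>"
proof -
  have "ind2 (\<phi>, \<omega>) = 0" if "lie_cocycle \<phi>"
  proof (intro ext)
    fix g h
    have c: "\<phi> \<in> cl_cochain2" using that by (simp add: lie_cocycle_def)
    show "ind2 (\<phi>, \<omega>) g h = 0 g h"
      using witt_perfect[OF additive_ind2[OF c] assms ind2_bracket[OF that assms]] by simp
  qed
  then show ?thesis
    by (auto simp: cocycles2_def res_cochain2_def delta2_def lie_cocycle_def zero_prod_def)
qed

lemma star_property_diff:
  assumes "star_property \<phi> \<omega>" "star_property \<phi>' \<omega>'"
  shows "star_property (\<lambda>g h. \<phi> g h - a * \<phi>' g h) (\<lambda>g. \<omega> g - a * \<omega>' g)"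
proof -
  have "star_sum (\<lambda>g h. \<phi> g h - a * \<phi>' g h) g h = star_sum \<phi> g h - a * star_sum \<phi>' g h" for g h
    by (simp add: star_sum_def right_diff_distrib sum_subtractf sum_distrib_left mult.left_commute)
  then show ?thesis
    using assms by (simp add: star_property_def algebra_simps)
qed

text \<open>A p-semilinear form in coordinates; these forms are exactly the companions of the zero
  cocycle.\<close>

definition frob_form :: "(nat \<Rightarrow> 'k::field_prime_char) \<Rightarrow> 'k witt \<Rightarrow> 'k" where
  "frob_form a g = (\<Sum>i<CHAR('k). a i * wcoeff g i ^ CHAR('k))"

lemma star_property_frob_form: "star_property 0 (frob_form a)"
  by (simp add: star_property_def star_sum_def frob_form_def wcoeff_simps power_mult_distrib
      freshmans_dream sum.distrib distrib_left sum_distrib_left mult.left_commute)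

lemma frob_form_witt_e: "i < CHAR('k) \<Longrightarrow> frob_form a (witt_e i :: 'k::field_prime_char witt) = a i"
  by (simp add: frob_form_def wcoeff_witt_e if_distrib[of "\<lambda>x. _ * x ^ _"] power_0_left cong: if_cong)

lemma star_property_0_conv_frob_form:
  fixes \<omega> :: "'k::field_prime_char witt \<Rightarrow> 'k"
  assumes "star_property 0 \<omega>"
  shows "\<omega> = frob_form (\<lambda>i. \<omega> (witt_e i))"
proof
  fix g
  have add: "additive \<omega>" and sc: "\<omega> (witt_scale c g) = c ^ CHAR('k) * \<omega> g" for c g
    using assms by (auto simp: star_property_def star_sum_def additive_def)
  show "\<omega> g = frob_form (\<lambda>i. \<omega> (witt_e i)) g"
    by (subst wcoeff_expansion) (simp add: additive.sum[OF add] sc frob_form_def mult.commute)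
qed

section \<open>Dimension count and classes in H^2\<close>

lemma (in vector_space) dim_family:
  fixes b :: "nat \<Rightarrow> 'b"
  assumes ind: "\<And>c. (\<Sum>i<n. scale (c i) (b i)) = 0 \<Longrightarrow> \<forall>i<n. c i = 0"
  defines "V \<equiv> range (\<lambda>c. \<Sum>i<n. scale (c i) (b i))"
  shows "subspace V \<and> dim V = n"
proof -
  let ?B = "b ` {..<n}"
  have inj: "inj_on b {..<n}"
  proof (rule inj_onI, rule ccontr)
    fix i j assume ij: "i \<in> {..<n}" "j \<in> {..<n}" "b i = b j" "i \<noteq> j"
    \<comment> \<open>A repeated vector would give the nontrivial relation b i - b j = 0.\<close>
    let ?c = "\<lambda>l. (if l = i then 1 else 0) - (if l = j then 1 else 0) :: 'a"
    have "(\<Sum>l<n. scale (?c l) (b l)) =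
        (\<Sum>l<n. if l = i then b l else 0) - (\<Sum>l<n. if l = j then b l else 0)"
      unfolding sum_subtractf[symmetric] by (intro sum.cong) (auto simp: scale_left_diff_distrib)
    also have "\<dots> = 0" using ij by simp
    finally have "\<forall>l<n. ?c l = 0" by (rule ind)
    then show False using ij by auto
  qed
  have sum_B: "(\<Sum>v\<in>?B. scale (u v) v) = (\<Sum>i<n. scale (u (b i)) (b i))" for u
    using inj by (simp add: sum.reindex)
  have "independent ?B"
  proof (rule independent_if_scalars_zero)
    fix u x assume "(\<Sum>v\<in>?B. scale (u v) v) = 0" "x \<in> ?B"
    then show "u x = 0"
      using ind[of "\<lambda>i. u (b i)"] by (auto simp: sum_B)
  qed simp
  moreover have "span ?B = V"
  proof
    show "span ?B \<subseteq> V"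
      unfolding V_def span_finite[OF finite_imageI[OF finite_lessThan]] sum_B by auto
    have "(\<Sum>i<n. scale (c i) (b i)) \<in> span ?B" for c
      by (intro span_sum span_scale span_base) auto
    then show "V \<subseteq> span ?B"
      unfolding V_def by blast
  qed
  moreover have "card ?B = n"
    using inj by (simp add: card_image)
  ultimately show ?thesis
    using dim_span_eq_card_independent[of ?B] subspace_span[of ?B] by auto
qed

lemma cohomologous_refl: "cohomologous x x \<longleftrightarrow> x \<in> cocycles2"
  using cochain2_vs.subspace_0[OF subspace_coboundaries2] by (auto simp: cohomologous_def)

lemma abs_res_H2_eq_iff:
  "x \<in> cocycles2 \<Longrightarrow> y \<in> cocycles2 \<Longrightarrow> abs_res_H2 x = abs_res_H2 y \<longleftrightarrow> x - y \<in> coboundaries2"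
  using Quotient_rel[OF Quotient_res_H2, of x y] by (auto simp: cohomologous_refl) (auto simp: cohomologous_def)

lemma abs_res_H2_surj: "\<exists>x\<in>cocycles2. v = abs_res_H2 x"
  using Quotient_abs_rep[OF Quotient_res_H2, of v] Quotient_rep_reflp[OF Quotient_res_H2, of v]
  by (metis cohomologous_refl)

lemma abs_res_H2_simps:
  "x \<in> cocycles2 \<Longrightarrow> y \<in> cocycles2 \<Longrightarrow> abs_res_H2 x + abs_res_H2 y = abs_res_H2 (x + y)"
  "x \<in> cocycles2 \<Longrightarrow> res_H2_scale c (abs_res_H2 x) = abs_res_H2 (cochain2_scale c x)"
  by (auto simp: plus_res_H2.abs_eq res_H2_scale.abs_eq cohomologous_refl)

lemma coboundaries2_fst: "x \<in> coboundaries2 \<Longrightarrow> \<exists>\<psi>\<in>cochain1. x = (cl_delta1 \<psi>, ind1 \<psi>)"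
  by (auto simp: coboundaries2_def delta1_def)

lemma frob_form_add: "frob_form (\<lambda>i. a i + b i) = frob_form a + frob_form b"
  and frob_form_scale: "frob_form (\<lambda>i. c * a i) = (\<lambda>g. c * frob_form a g)"
  by (simp_all add: fun_eq_iff frob_form_def distrib_right sum.distrib sum_distrib_left mult.assoc)

text \<open>The section is g \<mapsto> g + \<psi>(g) c; brackets match because the cocycle takes (g,
  h) to \<psi>([g, h]).\<close>

lemma lie_trivialI:
  assumes "\<psi> \<in> cochain1"
  shows "lie_trivial_extension (central_extension (cl_delta1 \<psi>, \<omega>))"
proof -
  interpret ext: lie_alg ext_scale "ext_bracket (cl_delta1 \<psi>)"
    by (rule lie_alg_ext[OF lie_cocycle_delta1[OF assms]])
  have sc: "(\<lambda>c (g, a). (witt_scale c g, c * a)) = ext_scale"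
    by (auto simp: ext_scale_def fun_eq_iff)
  have "Vector_Spaces.linear witt_scale ext_scale (\<lambda>g. (g, \<psi> g))"
    unfolding Vector_Spaces.linear_def module_hom_def module_hom_axioms_def
    using additive.add[OF cochain1D(1)[OF assms]] cochain1D(2)[OF assms]
    by (auto simp: witt_vs.vector_space_axioms witt_vs.module_axioms ext.vector_space_axioms
        ext.module_axioms ext_scale_def)
  then have "lie_hom witt_algebra (central_extension (cl_delta1 \<psi>, \<omega>)) (\<lambda>g. (g, \<psi> g))"
    by (simp add: lie_hom_def witt_algebra_def central_extension_def sc cl_delta1_def)
  then show ?thesis
    unfolding lie_trivial_extension_def by (intro exI[of _ "\<lambda>g. (g, \<psi> g)"]) simp
qed

theorem theorem3p1:
  fixes p :: nat
  assumes "prime p" and "p > 3"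
    and "CHAR('k::{alg_closed_field, field_prime_char}) = p"
  shows "res_H2_vs.dim (UNIV :: 'k res_H2 set) = p + 1 \<and>
    (\<exists>V :: 'k res_H2 set. res_H2_vs.subspace V \<and> res_H2_vs.dim V = p \<and>
       (\<forall>x \<in> cocycles2. abs_res_H2 x \<in> V \<longrightarrow> lie_trivial_extension (central_extension x)))"
proof -
  have p: "CHAR('k) = p" "CHAR('k) > 2" "CHAR('k) > 3" using assms by simp_all
  note [simp] = cochain2_vs.subspace_add[OF subspace_cocycles2] cochain2_vs.subspace_scale[OF subspace_cocycles2]
  let ?vir = "vir_cocycle :: 'k witt \<Rightarrow> 'k witt \<Rightarrow> 'k"
  obtain \<omega>0 where \<omega>0: "star_property ?vir \<omega>0"
    using star_property_exists[OF lie_cocycle_vir[OF p(2)] p(2)] .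
  \<comment> \<open>\<open>F a\<close> represents the classes with \<phi> = 0, and \<open>U\<close>
    the Virasoro class.\<close>
  define F where "F a = (0 :: 'k witt \<Rightarrow> 'k witt \<Rightarrow> 'k, frob_form a)" for a :: "nat \<Rightarrow> 'k"
  define U where "U = (?vir, \<omega>0)"
  have "lie_cocycle (0 :: 'k witt \<Rightarrow> 'k witt \<Rightarrow> 'k)"
    by (simp add: lie_cocycle_def cl_cochain2_def linear_witt_iff cl_delta2_def fun_eq_iff)
  then have F [simp]: "F a \<in> cocycles2" for a
    by (simp add: F_def cocycles2_iff[OF p(2)] star_property_frob_form)
  have U [simp]: "U \<in> cocycles2"
    by (simp add: U_def cocycles2_iff[OF p(2)] lie_cocycle_vir[OF p(2)] \<omega>0)
  define v where "v a t = abs_res_H2 (F a) + res_H2_scale t (abs_res_H2 U)" for a t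
  have v: "v a t = abs_res_H2 (F a + cochain2_scale t U)" for a t
    by (simp add: v_def abs_res_H2_simps)
  have v_surj: "\<exists>a t. x = v a t" for x
  proof -
    obtain \<phi> \<omega> where x: "(\<phi>, \<omega>) \<in> cocycles2" "x = abs_res_H2 (\<phi>, \<omega>)"
      using abs_res_H2_surj[of x] by auto
    then have \<phi>: "lie_cocycle \<phi>" "star_property \<phi> \<omega>"
      by (simp_all add: cocycles2_iff[OF p(2)])
    obtain t \<psi> where \<psi>: "\<psi> \<in> cochain1" and eq: "\<And>g h. \<phi> g h = t * vir_cocycle g h + cl_delta1 \<psi> g h"
      by (rule lie_cocycle_classification[OF \<phi>(1) p(3)]) (rule that)
    \<comment> \<open>Removing the Virasoro part and the coboundary leaves a companion of the zero
      cocycle, which is p-semilinear. The factor 1 fits the second use of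
      \<open>star_property_diff\<close>.\<close>
    have "star_property (\<lambda>g h. \<phi> g h - t * vir_cocycle g h - 1 * cl_delta1 \<psi> g h) (\<lambda>g. \<omega> g - t * \<omega>0 g - 1 * ind1 \<psi> g)"
      by (intro star_property_diff \<phi> \<omega>0 star_property_ind1[OF \<psi> p(2)])
    then have "star_property 0 (\<lambda>g. \<omega> g - t * \<omega>0 g - ind1 \<psi> g)"
      by (simp add: eq zero_fun_def)
    then obtain a where a: "(\<lambda>g. \<omega> g - t * \<omega>0 g - ind1 \<psi> g) = frob_form a"
      using star_property_0_conv_frob_form by blast
    have "(\<phi>, \<omega>) - (F a + cochain2_scale t U) = delta1 \<psi>"
      by (simp add: F_def U_def cochain2_scale_def delta1_def fun_eq_iff eq flip: a)
    then have "x = v a t"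
      using x \<psi> by (simp add: v abs_res_H2_eq_iff coboundaries2_def)
    then show ?thesis by blast
  qed
  have v_0: "t = 0 \<and> (\<forall>i<p. a i = 0)" if "v a t = 0" for a t
  proof -
    have "abs_res_H2 (F a + cochain2_scale t U) = abs_res_H2 0"
      using that by (simp add: v zero_res_H2_def)
    then have "F a + cochain2_scale t U \<in> coboundaries2"
      using cochain2_vs.subspace_0[OF subspace_cocycles2] by (subst (asm) abs_res_H2_eq_iff) simp_all
    then obtain \<psi> where \<psi>: "\<psi> \<in> cochain1" "F a + cochain2_scale t U = (cl_delta1 \<psi>, ind1 \<psi>)"
      using coboundaries2_fst by blast
    then have eq: "t * vir_cocycle g h = \<psi> (witt_bracket g h)" "frob_form a g + t * \<omega>0 g = \<psi> (witt_pmap g)" for g h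
      by (auto simp: F_def U_def cochain2_scale_def cl_delta1_def ind1_def fun_eq_iff)
    have two: "(2 :: 'k) \<noteq> 0" and six: "(6 :: 'k) \<noteq> 0"
      using of_nat_nonzero[of 2, where 'k = 'k] of_nat_nonzero[of 3, where 'k = 'k] p(3)
        mult_eq_0_iff[of "2 :: 'k" 3] by simp_all
    \<comment> \<open>A cubic is compared with a linear function of i: i = 1 forces \<psi>(e_0) = 0,
      and then i = 2 forces 6 t = 0.\<close>
    have weight0: "t * (of_nat i ^ 3 - of_nat i) = - 2 * of_nat i * \<psi> (witt_e 0)" if "i < p" for i
    proof -
      have "of_nat (p - i) = (- of_nat i :: 'k)"
        using that of_nat_CHAR[where 'a = 'k] by (simp add: of_nat_diff p(1))
      moreover have "witt_e (i + (p - i)) = (witt_e 0 :: 'k witt)"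
        using that p(1) by (intro witt_e_cong) simp
      ultimately show ?thesis
        using eq(1)[of "witt_e i" "witt_e (p - i)"] that p(1)
        by (simp add: vir_cocycle_witt_e bracket_witt_e cochain1D(2)[OF \<psi>(1)] additive.minus[OF cochain1D(1)[OF \<psi>(1)]])
    qed
    have "\<psi> (witt_e 0) = 0"
      using weight0[of 1] two assms(2) by simp
    then have t: "t = 0"
      using weight0[of 2] six assms(2) by simp
    \<comment> \<open>With t = 0 the form \<psi> kills all brackets, so perfectness applies.\<close>
    have "\<psi> g = 0" for g
      by (rule witt_perfect[OF cochain1D[OF \<psi>(1)] p(2)]) (simp add: t flip: eq(1))
    then show ?thesis
      using eq(2) t frob_form_witt_e[where 'k = 'k] p(1) by (metis add.right_neutral mult_zero_left)
  qed
  \<comment> \<open>The coordinate p-semilinear forms occupy the indices below p; the Virasoro class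
    has index p.\<close>
  define b where "b i = (if i < p then v (\<lambda>j. if j = i then 1 else 0) 0 else abs_res_H2 U)" for i
  have Fadd: "abs_res_H2 (F a) + res_H2_scale c (abs_res_H2 (F a')) = abs_res_H2 (F (\<lambda>i. a i + c * a' i))" for a a' c
    by (simp add: abs_res_H2_simps)
      (simp add: F_def cochain2_scale_def frob_form_add[of a "\<lambda>i. c * a' i"] frob_form_scale zero_fun_def plus_fun_def)
  have sum_b: "(\<Sum>i<n. res_H2_scale (c i) (b i)) = abs_res_H2 (F (\<lambda>i. if i < n then c i else 0))" if "n \<le> p" for n c
    using that
  proof (induction n)
    case 0
    have "F (\<lambda>i. 0) = 0" by (simp add: F_def frob_form_def zero_prod_def fun_eq_iff)
    then show ?case by (simp add: zero_res_H2_def)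
  next
    case (Suc n)
    have "(\<lambda>i. (if i < n then c i else 0) + c n * (if i = n then 1 else 0)) = (\<lambda>i. if i < Suc n then c i else 0)"
      by (auto simp: fun_eq_iff less_Suc_eq)
    moreover have "b n = abs_res_H2 (F (\<lambda>j. if j = n then 1 else 0))"
      using Suc by (simp add: b_def v_def)
    ultimately show ?case
      using Suc by (simp only: sum.lessThan_Suc Fadd Suc_leD)
  qed
  have F_cong: "F a = F a'" if "\<And>i. i < p \<Longrightarrow> a i = a' i" for a a'
    using that p(1) by (simp add: F_def frob_form_def fun_eq_iff)
  have sum_p: "(\<Sum>i<p. res_H2_scale (c i) (b i)) = v c 0" for c
    unfolding sum_b[OF order_refl] v_def using F_cong[of "\<lambda>i. if i < p then c i else 0" c] by simp
  have sum_Suc: "(\<Sum>i<Suc p. res_H2_scale (c i) (b i)) = v c (c p)" for c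
    unfolding sum.lessThan_Suc sum_p by (simp add: v_def b_def)
  define V where "V = range (\<lambda>c. \<Sum>i<p. res_H2_scale (c i) (b i))"
  have V: "res_H2_vs.subspace V \<and> res_H2_vs.dim V = p"
    unfolding V_def by (rule res_H2_vs.dim_family) (use v_0 in \<open>auto simp: sum_p\<close>)
  have "res_H2_vs.dim (range (\<lambda>c. \<Sum>i<Suc p. res_H2_scale (c i) (b i))) = Suc p"
  proof (rule conjunct2[OF res_H2_vs.dim_family])
    show "\<forall>i<Suc p. c i = 0" if "(\<Sum>i<Suc p. res_H2_scale (c i) (b i)) = 0" for c
      using v_0[of c "c p"] that unfolding sum_Suc by (auto simp: less_Suc_eq)
  qed
  moreover have "range (\<lambda>c. \<Sum>i<Suc p. res_H2_scale (c i) (b i)) = UNIV"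
  proof -
    have "x \<in> range (\<lambda>c. v c (c p))" for x
    proof -
      obtain a t where "x = v a t" using v_surj by blast
      \<comment> \<open>\<open>frob_form\<close> reads only the indices below p, so index p is free
        to carry t.\<close>
      also have "v a t = v (a(p := t)) t"
        unfolding v_def using F_cong[of a "a(p := t)"] by simp
      finally show ?thesis by (intro image_eqI[of _ _ "a(p := t)"]) simp_all
    qed
    then show ?thesis unfolding sum_Suc by blast
  qed
  \<comment> \<open>A class in \<open>V\<close> contains some \<open>F a\<close>, so the \<phi> of
    any of its representatives is an ordinary coboundary.\<close>
  moreover have "lie_trivial_extension (central_extension x)" if x: "x \<in> cocycles2" "abs_res_H2 x \<in> V" for x
  proof -
    obtain a where "abs_res_H2 x = abs_res_H2 (F a)"
      using x(2) by (auto simp: V_def sum_p v_def)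
    then have "x - F a \<in> coboundaries2"
      using x by (simp add: abs_res_H2_eq_iff)
    then obtain \<psi> where \<psi>: "\<psi> \<in> cochain1" "x - F a = (cl_delta1 \<psi>, ind1 \<psi>)"
      using coboundaries2_fst by blast
    then have "x = (cl_delta1 \<psi>, snd x)"
      by (auto simp: F_def prod_eq_iff)
    then show ?thesis
      using lie_trivialI[OF \<psi>(1), of "snd x"] by simp
  qed
  ultimately show ?thesis
    using V by auto
qed

end
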